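(* Let $C$ be a conjugation on a Hilbert space $\mathcal H$ and let $V\in\mathbf B(\mathcal H_V,\mathcal H)$ be a $C$-symmetric contraction with $\operatorname{dom}V=\mathcal H_V$ a closed subspace of $\mathcal H$. Let $X_0$, $\mathcal L_0$, $\widetilde X_0$, $\widetilde V_{X_0^*}$ and $\widetilde W_0$ be as defined in the context. If $$\operatorname{ran}\mathcal D_{V^*}\cap C\mathcal H_V^\perp=\{0\},$$ then (a) $\widetilde W_0=\widetilde V_{X_0^*}$; (b) $\mathcal L_0=\mathfrak D_{V^*}$ and $X_0$ is a co-isometry; (c) $P_{\mathcal H_V^\perp}C\mathcal D_{V^*}X_0^*f=\widetilde X_0\mathcal D_{V^*}Cf$ for all $f\in\mathcal H_V^\perp$; (d) $\widetilde W_0$ is the unique $C$-self-adjoint contractive extension of $V$ on $\mathcal H$ and, moreover, $\widetilde W_0$ is the unique contractive extension of the adjoint pair $\{V,CVC\}$ of contractions.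
   Context: $\mathbf B(\mathcal H_1,\mathcal H_2)$ denotes the bounded linear operators from $\mathcal H_1$ to $\mathcal H_2$. A conjugation on $\mathcal H$ is an anti-linear isometric operator $C$ on $\mathcal H$ with $C^2=I$. $V$ is $C$-symmetric if $(Vf,Cg)=(f,CVg)$ for all $f,g\in\mathcal H_V$. A bounded operator $B$ on $\mathcal H$ is $C$-self-adjoint if $B=CB^*C$. $\mathcal H_V^\perp:=\mathcal H\ominus\mathcal H_V$, $P_{\mathfrak M}$ is the orthogonal projection onto $\mathfrak M$, and $V^*\in\mathbf B(\mathcal H,\mathcal H_V)$ is the adjoint of $V\in\mathbf B(\mathcal H_V,\mathcal H)$. For a contraction $Z\in\mathbf B(\mathcal H_1,\mathcal H_2)$: $\mathcal D_Z:=(I-Z^*Z)^{1/2}$, $\mathfrak D_Z:=\overline{\operatorname{ran}}\,\mathcal D_Z$; thus $\mathcal D_{V^*}=(I-VV^* )^{1/2}$. The map $\mathcal D_{V^*}Ch\mapsto P_{\mathcal H_V^\perp}CVh$, $h\in\mathcal H_V$, is a well-defined linear contraction; $X_0$ denotes its continuous extension to a contraction $X_0\in\mathbf B(\mathcal L_0,\mathcal H_V^\perp)$, where $\mathcal L_0:=\overline{\mathcal D_{V^*}C\mathcal H_V}\subseteq\mathfrak D_{V^*}$. $X_0^*\in\mathbf B(\mathcal H_V^\perp,\mathcal L_0)$ is its adjoint and $\widetilde X_0:=X_0P_{\mathcal L_0}$ on $\mathfrak D_{V^*}$. Put $\widetilde V_{X_0^*}:=VP_{\mathcal H_V}+\mathcal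 D_{V^*}X_0^*P_{\mathcal H_V^\perp}$ and $\widetilde W_0:=\frac12\left(\widetilde V_{X_0^*}+C\widetilde V_{X_0^*}^*C\right)$. A co-isometry is an operator whose adjoint is an isometry. The operator $CVC$ is defined on $C\mathcal H_V$, and $\{V,CVC\}$ is an adjoint pair, i.e. $(Vf,h)=(f,CVCh)$ for $f\in\mathcal H_V$, $h\in C\mathcal H_V$. A contractive extension of the adjoint pair $\{V,CVC\}$ is a contraction $\widetilde V\in\mathbf B(\mathcal H,\mathcal H)$ with $\widetilde V\supset V$ and $\widetilde V^*\supset CVC$. *)

theory Defs
  imports "HOL-Analysis.Analysis"
begin

section \<open>Complex Hilbert spaces\<close>

text \<open>The real inner product inherited from \<^class>\<open>real_inner\<close> is the real part of the
  complex one, so norm and topology are those induced by the complex inner product, which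
  is linear in its first argument.  Positivity and definiteness are inherited as well.\<close>

class complex_inner = real_inner +
  fixes scaleC :: "complex \<Rightarrow> 'a \<Rightarrow> 'a" (infixr \<open>*\<^sub>C\<close> 75)
    and cinner :: "'a \<Rightarrow> 'a \<Rightarrow> complex"
  assumes scaleC_add_right: "a *\<^sub>C (x + y) = a *\<^sub>C x + a *\<^sub>C y"
    and scaleC_add_left: "(a + b) *\<^sub>C x = a *\<^sub>C x + b *\<^sub>C x"
    and scaleC_scaleC: "a *\<^sub>C b *\<^sub>C x = (a * b) *\<^sub>C x"
    and scaleC_of_real: "complex_of_real r *\<^sub>C x = r *\<^sub>R x"
    and cinner_commute: "cinner x y = cnj (cinner y x)"
    and cinner_add_left: "cinner (x + y) z = cinner x z + cinner y z"
    and cinner_scaleC_left: "cinner (a *\<^sub>C x) y = a * cinner x y"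
    and inner_eq_Re_cinner: "inner x y = Re (cinner x y)"

class complex_hilbert = complex_inner + complete_space

instantiation complex :: complex_hilbert
begin

definition scaleC_complex :: "complex \<Rightarrow> complex \<Rightarrow> complex"
  where "scaleC_complex a x = a * x"

definition cinner_complex :: "complex \<Rightarrow> complex \<Rightarrow> complex"
  where "cinner_complex x y = x * cnj y"

instance
  by standard
    (auto simp: scaleC_complex_def cinner_complex_def inner_complex_def algebra_simps
      scaleR_conv_of_real)

end

section \<open>Subspaces and operators\<close>

text \<open>An operator in \<open>B(M, N)\<close>, for closed subspaces \<open>M\<close> and \<open>N\<close>, is represented by a
  function on the ambient type of which only the values on \<open>M\<close> are relevant.\<close>

definition csubspace :: "'a::complex_inner set \<Rightarrow> bool"
  where "csubspace M \<longleftrightarrow>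
    0 \<in> M \<and> (\<forall>x\<in>M. \<forall>y\<in>M. x + y \<in> M) \<and> (\<forall>a. \<forall>x\<in>M. a *\<^sub>C x \<in> M)"

definition closed_csubspace :: "'a::complex_inner set \<Rightarrow> bool"
  where "closed_csubspace M \<longleftrightarrow> csubspace M \<and> closed M"

definition ocompl :: "'a::complex_inner set \<Rightarrow> 'a set"
  where "ocompl M = {x. \<forall>y\<in>M. cinner x y = 0}"

definition proj :: "'a::complex_inner set \<Rightarrow> 'a \<Rightarrow> 'a"
  where "proj M x = (THE p. p \<in> M \<and> x - p \<in> ocompl M)"

definition bounded_ops ::
    "'a::complex_inner set \<Rightarrow> 'b::complex_inner set \<Rightarrow> ('a \<Rightarrow> 'b) set"
  where "bounded_ops M N = {T.
    (\<forall>x\<in>M. T x \<in> N) \<and>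
    (\<forall>x\<in>M. \<forall>y\<in>M. T (x + y) = T x + T y) \<and>
    (\<forall>a. \<forall>x\<in>M. T (a *\<^sub>C x) = a *\<^sub>C T x) \<and>
    (\<exists>K. \<forall>x\<in>M. norm (T x) \<le> K * norm x)}"

definition contraction ::
    "'a::complex_inner set \<Rightarrow> 'b::complex_inner set \<Rightarrow> ('a \<Rightarrow> 'b) \<Rightarrow> bool"
  where "contraction M N T \<longleftrightarrow> T \<in> bounded_ops M N \<and> (\<forall>x\<in>M. norm (T x) \<le> norm x)"

definition isometry ::
    "'a::complex_inner set \<Rightarrow> 'b::complex_inner set \<Rightarrow> ('a \<Rightarrow> 'b) \<Rightarrow> bool"
  where "isometry M N T \<longleftrightarrow> T \<in> bounded_ops M N \<and> (\<forall>x\<in>M. norm (T x) = norm x)"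

text \<open>\<open>adj M N T\<close> is the adjoint in \<open>B(N, M)\<close> of \<open>T\<close> in \<open>B(M, N)\<close>.\<close>

definition adj ::
    "'a::complex_inner set \<Rightarrow> 'b::complex_inner set \<Rightarrow> ('a \<Rightarrow> 'b) \<Rightarrow> 'b \<Rightarrow> 'a"
  where "adj M N T y = (THE x. x \<in> M \<and> (\<forall>z\<in>M. cinner (T z) y = cinner z x))"

definition coisometry ::
    "'a::complex_inner set \<Rightarrow> 'b::complex_inner set \<Rightarrow> ('a \<Rightarrow> 'b) \<Rightarrow> bool"
  where "coisometry M N T \<longleftrightarrow> T \<in> bounded_ops M N \<and> isometry N M (adj M N T)"

definition nonneg_op :: "'a::complex_inner set \<Rightarrow> ('a \<Rightarrow> 'a) \<Rightarrow> bool"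
  where "nonneg_op M R \<longleftrightarrow> R \<in> bounded_ops M M \<and> (\<forall>x\<in>M. cinner (R x) x \<in> \<real>\<^sub>\<ge>\<^sub>0)"

text \<open>The nonnegative square root; extensionality makes it unique as a function.\<close>

definition sqrt_op :: "'a::complex_inner set \<Rightarrow> ('a \<Rightarrow> 'a) \<Rightarrow> 'a \<Rightarrow> 'a"
  where "sqrt_op M A =
    (THE R. R \<in> extensional M \<and> nonneg_op M R \<and> (\<forall>x\<in>M. R (R x) = A x))"

definition defect_op ::
    "'a::complex_inner set \<Rightarrow> 'b::complex_inner set \<Rightarrow> ('a \<Rightarrow> 'b) \<Rightarrow> 'a \<Rightarrow> 'a"
  where "defect_op M N Z = sqrt_op M (\<lambda>x. x - adj M N Z (Z x))"

definition defect_space ::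
    "'a::complex_inner set \<Rightarrow> 'b::complex_inner set \<Rightarrow> ('a \<Rightarrow> 'b) \<Rightarrow> 'a set"
  where "defect_space M N Z = closure (defect_op M N Z ` M)"

section \<open>Conjugations, symmetric operators, adjoint pairs\<close>

definition conjugation :: "('a::complex_inner \<Rightarrow> 'a) \<Rightarrow> bool"
  where "conjugation C \<longleftrightarrow>
    (\<forall>x y. C (x + y) = C x + C y) \<and> (\<forall>a x. C (a *\<^sub>C x) = cnj a *\<^sub>C C x) \<and>
    (\<forall>x. norm (C x) = norm x) \<and> (\<forall>x. C (C x) = x)"

definition C_symmetric :: "('a::complex_inner \<Rightarrow> 'a) \<Rightarrow> 'a set \<Rightarrow> ('a \<Rightarrow> 'a) \<Rightarrow> bool"
  where "C_symmetric C S V \<longleftrightarrow> (\<forall>f\<in>S. \<forall>g\<in>S. cinner (V f) (C g) = cinner f (C (V g)))"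

definition C_selfadjoint :: "('a::complex_inner \<Rightarrow> 'a) \<Rightarrow> ('a \<Rightarrow> 'a) \<Rightarrow> bool"
  where "C_selfadjoint C B \<longleftrightarrow>
    B \<in> bounded_ops UNIV UNIV \<and> (\<forall>x. B x = C (adj UNIV UNIV B (C x)))"

definition extends :: "('a \<Rightarrow> 'b) \<Rightarrow> 'a set \<Rightarrow> ('a \<Rightarrow> 'b) \<Rightarrow> bool"
  where "extends W S V \<longleftrightarrow> (\<forall>f\<in>S. W f = V f)"

definition adjoint_pair ::
    "'a::complex_inner set \<Rightarrow> ('a \<Rightarrow> 'a) \<Rightarrow> 'a set \<Rightarrow> ('a \<Rightarrow> 'a) \<Rightarrow> bool"
  where "adjoint_pair S A T B \<longleftrightarrow> (\<forall>f\<in>S. \<forall>h\<in>T. cinner (A f) h = cinner f (B h))"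

definition C_selfadjoint_contractive_extension ::
    "('a::complex_inner \<Rightarrow> 'a) \<Rightarrow> 'a set \<Rightarrow> ('a \<Rightarrow> 'a) \<Rightarrow> ('a \<Rightarrow> 'a) \<Rightarrow> bool"
  where "C_selfadjoint_contractive_extension C S V W \<longleftrightarrow>
    contraction UNIV UNIV W \<and> extends W S V \<and> C_selfadjoint C W"

definition contractive_pair_extension ::
    "'a::complex_inner set \<Rightarrow> ('a \<Rightarrow> 'a) \<Rightarrow> 'a set \<Rightarrow> ('a \<Rightarrow> 'a) \<Rightarrow> ('a \<Rightarrow> 'a) \<Rightarrow> bool"
  where "contractive_pair_extension S A T B W \<longleftrightarrow>
    contraction UNIV UNIV W \<and> extends W S A \<and> extends (adj UNIV UNIV W) T B"

lemma C_symmetric_imp_adjoint_pair: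
  assumes "conjugation C" and "C_symmetric C S V"
  shows "adjoint_pair S V (C ` S) (\<lambda>h. C (V (C h)))"
  using assms by (auto simp: adjoint_pair_def C_symmetric_def conjugation_def)

section \<open>The extension of a symmetric contraction\<close>

text \<open>Throughout, \<open>V\<close> is a contraction in \<open>B(S, H)\<close>, where \<open>H\<close> is the whole type.\<close>

definition D_Vstar :: "'a::complex_inner set \<Rightarrow> ('a \<Rightarrow> 'a) \<Rightarrow> 'a \<Rightarrow> 'a"
  where "D_Vstar S V = defect_op UNIV S (adj S UNIV V)"

definition DD_Vstar :: "'a::complex_inner set \<Rightarrow> ('a \<Rightarrow> 'a) \<Rightarrow> 'a set"
  where "DD_Vstar S V = defect_space UNIV S (adj S UNIV V)"

definition L0 :: "('a::complex_inner \<Rightarrow> 'a) \<Rightarrow> 'a set \<Rightarrow> ('a \<Rightarrow> 'a) \<Rightarrow> 'a set"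
  where "L0 C S V = closure (D_Vstar S V ` C ` S)"

definition X0 :: "('a::complex_inner \<Rightarrow> 'a) \<Rightarrow> 'a set \<Rightarrow> ('a \<Rightarrow> 'a) \<Rightarrow> 'a \<Rightarrow> 'a"
  where "X0 C S V = (THE X. X \<in> extensional (L0 C S V) \<and>
    contraction (L0 C S V) (ocompl S) X \<and>
    (\<forall>h\<in>S. X (D_Vstar S V (C h)) = proj (ocompl S) (C (V h))))"

definition X0_star :: "('a::complex_inner \<Rightarrow> 'a) \<Rightarrow> 'a set \<Rightarrow> ('a \<Rightarrow> 'a) \<Rightarrow> 'a \<Rightarrow> 'a"
  where "X0_star C S V = adj (L0 C S V) (ocompl S) (X0 C S V)"

definition X0_tilde :: "('a::complex_inner \<Rightarrow> 'a) \<Rightarrow> 'a set \<Rightarrow> ('a \<Rightarrow> 'a) \<Rightarrow> 'a \<Rightarrow> 'a"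
  where "X0_tilde C S V x = X0 C S V (proj (L0 C S V) x)"

definition V_tilde :: "('a::complex_inner \<Rightarrow> 'a) \<Rightarrow> 'a set \<Rightarrow> ('a \<Rightarrow> 'a) \<Rightarrow> 'a \<Rightarrow> 'a"
  where "V_tilde C S V x =
    V (proj S x) + D_Vstar S V (X0_star C S V (proj (ocompl S) x))"

definition W0_tilde :: "('a::complex_inner \<Rightarrow> 'a) \<Rightarrow> 'a set \<Rightarrow> ('a \<Rightarrow> 'a) \<Rightarrow> 'a \<Rightarrow> 'a"
  where "W0_tilde C S V x =
    (1/2) *\<^sub>C (V_tilde C S V x + C (adj UNIV UNIV (V_tilde C S V) (C x)))"

end

theory Submission
  imports Defs
begin

text \<open>
  Write \<open>D\<close> for \<open>(I - V V\<^sup>*)\<^bsup>1/2\<^esup>\<close>, \<open>P\<close> and \<open>Q\<close> for the projections onto \<open>S\<close> and its orthogonal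
  complement, and \<open>W\<close> for \<open>V_tilde C S V\<close>.

  The adjoint of \<open>W\<close> is \<open>V\<^sup>* + X\<^sub>0\<^sup>~ D\<close>.  It is a contraction because its two summands have orthogonal
  values and \<open>\<parallel>V\<^sup>*x\<parallel>\<^sup>2 + \<parallel>Dx\<parallel>\<^sup>2 = \<parallel>x\<parallel>\<^sup>2\<close>, and it agrees with \<open>CVC\<close> on \<open>CS\<close> by the choice of \<open>X\<^sub>0\<close>.  So \<open>W\<close> is a
  contractive extension of the adjoint pair, and so is \<open>CW\<^sup>*C\<close>.

  The hypothesis enters through a range inclusion principle in the style of Douglas
  (\<open>in_range_if_majorised\<close>): if \<open>\<bar>(x, w)\<bar> \<le> K\<parallel>Dx\<parallel>\<close> for all \<open>x\<close>, then \<open>w\<close> lies in the range of \<open>D\<close>.  If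
  moreover \<open>w\<close> is orthogonal to \<open>CS\<close>, the hypothesis gives \<open>w = 0\<close>.  This is used twice.

  \<^item> If \<open>W\<^sub>1\<close>, \<open>W\<^sub>2\<close> are contractive extensions of the pair and \<open>g\<close> is orthogonal to \<open>S\<close>, the principle
    applies to \<open>w = W\<^sub>1g - W\<^sub>2g\<close> (\<open>pair_extension_unique\<close>).  Hence \<open>W = CW\<^sup>*C\<close>, which yields the identity
    of \<open>W\<close> and \<open>W0_tilde C S V\<close>, the \<open>C\<close>-self-adjointness, both uniqueness statements and, on projecting
    \<open>CWf = W\<^sup>*Cf\<close>, the formula for \<open>Q C D X\<^sub>0\<^sup>*\<close>.

  \<^item> With \<open>G = I - X\<^sub>0X\<^sub>0\<^sup>*\<close>, the \<open>C\<close>-self-adjointness of \<open>W\<close> gives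
    \<open>\<parallel>GQx\<parallel>\<^sup>2 \<le> \<parallel>x\<parallel>\<^sup>2 - \<parallel>Wx\<parallel>\<^sup>2 = \<parallel>Cx\<parallel>\<^sup>2 - \<parallel>W\<^sup>*Cx\<parallel>\<^sup>2 \<le> \<parallel>DCx\<parallel>\<^sup>2\<close> (\<open>norm_X_Xs_defect_le\<close>), so the
    principle applies to \<open>w = CGk\<close> for \<open>k\<close> orthogonal to \<open>S\<close>.  Hence \<open>G = 0\<close> and \<open>X\<^sub>0\<^sup>*\<close> is isometric (\<open>X_Xs\<close>).

  The equality of \<open>L0 C S V\<close> and \<open>DD_Vstar S V\<close> is a direct consequence of the hypothesis (\<open>L_eq\<close>).

  Adjoints and projections come from the Riesz theorem, and \<open>D\<close> is \<open>I - Y\<close> for the limit \<open>Y\<close> of the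
  iteration \<open>Y \<mapsto> (B + Y\<^sup>2)/2\<close> with \<open>B = V V\<^sup>*\<close>, whose increments are majorised by those of the
  scalar iteration with \<open>B = 1\<close>.
\<close>

section \<open>Complex inner products\<close>

lemma scaleC_one [simp]: "1 *\<^sub>C x = (x::'a::complex_inner)"
  using scaleC_of_real[of 1 x] by simp

lemma scaleC_minus_one: "(-1) *\<^sub>C x = - (x::'a::complex_inner)"
  using scaleC_of_real[of "-1" x] by simp

lemma cinner_add_right: "cinner x (y + z) = cinner x y + cinner x z"
  by (metis cinner_add_left cinner_commute complex_cnj_add)

lemma cinner_scaleC_right: "cinner x (a *\<^sub>C y) = cnj a * cinner x y"
  by (metis cinner_commute cinner_scaleC_left complex_cnj_mult)

lemma cinner_minus_left: "cinner (- x) y = - cinner x y"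
  using cinner_scaleC_left[of "-1" x y] by (simp add: scaleC_minus_one)

lemma cinner_minus_right: "cinner x (- y) = - cinner x y"
  using cinner_scaleC_right[of x "-1" y] by (simp add: scaleC_minus_one)

lemma cinner_diff_left: "cinner (x - y) z = cinner x z - cinner y z"
  using cinner_add_left[of x "- y" z] by (simp add: cinner_minus_left)

lemma cinner_diff_right: "cinner x (y - z) = cinner x y - cinner x z"
  using cinner_add_right[of x y "- z"] by (simp add: cinner_minus_right)

lemma cinner_zero_left [simp]: "cinner 0 x = 0"
  using cinner_add_left[of 0 0 x] by simp

lemma cinner_zero_right [simp]: "cinner x 0 = 0"
  using cinner_add_right[of x 0 0] by simp

lemma cinner_self: "cinner x x = complex_of_real ((norm x)\<^sup>2)"
proof -
  have "Im (cinner x x) = 0"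
    using arg_cong[OF cinner_commute[of x x], of Im] by simp
  then show ?thesis
    by (simp add: complex_eq_iff inner_eq_Re_cinner[symmetric] power2_norm_eq_inner)
qed

lemma Im_cinner: "Im (cinner x y) = inner x (\<i> *\<^sub>C y)"
  by (simp add: inner_eq_Re_cinner cinner_scaleC_right)

lemma cinner_extensionality:
  assumes "\<And>z. cinner z x = cinner z y"
  shows "x = y"
  using assms[of "x - y"] cinner_self[of "x - y"] by (simp add: cinner_diff_right)

lemma norm_scaleC: "norm (a *\<^sub>C x) = cmod a * norm (x::'a::complex_inner)"
proof -
  have "complex_of_real ((norm (a *\<^sub>C x))\<^sup>2) = (a * cnj a) * cinner x x"
    by (simp add: cinner_self[symmetric] cinner_scaleC_left cinner_scaleC_right del: of_real_power)
  also have "\<dots> = complex_of_real ((cmod a * norm x)\<^sup>2)"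
    by (simp add: cinner_self complex_norm_square[symmetric] power_mult_distrib)
  finally show ?thesis
    unfolding of_real_eq_iff by (simp add: power2_eq_iff_nonneg)
qed

text \<open>Multiplying \<open>x\<close> by a unimodular scalar makes the complex inner product real and nonnegative, so
  the real Cauchy-Schwarz inequality applies.\<close>

lemma cmod_cinner_le: "cmod (cinner x y) \<le> norm x * norm y"
proof (cases "cinner x y = 0")
  case False
  define a where "a = cnj (sgn (cinner x y))"
  have 1: "cmod a = 1"
    using False by (simp add: a_def norm_sgn)
  have "cmod (cinner x y) = Re (a * cinner x y)"
    using False by (simp add: a_def sgn_eq complex_norm_square[symmetric] mult.commute power2_eq_square
       flip: of_real_mult)
  also have "\<dots> = inner (a *\<^sub>C x) y"
    by (simp add: inner_eq_Re_cinner cinner_scaleC_left)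
  also have "\<dots> \<le> norm (a *\<^sub>C x) * norm y"
    by (rule norm_cauchy_schwarz)
  finally show ?thesis by (simp add: norm_scaleC 1)
qed simp

lemma bounded_bilinear_cinner: "bounded_bilinear (cinner :: 'a::complex_inner \<Rightarrow> 'a \<Rightarrow> complex)"
proof
  show "\<exists>K. \<forall>a b::'a. norm (cinner a b) \<le> norm a * norm b * K"
    by (intro exI[of _ 1]) (simp add: cmod_cinner_le)
qed (auto simp: cinner_add_left cinner_add_right cinner_scaleC_left cinner_scaleC_right scaleR_conv_of_real
    simp flip: scaleC_of_real)

lemma bounded_linear_scaleC: "bounded_linear (\<lambda>x::'a::complex_inner. a *\<^sub>C x)"
proof (rule bounded_linear_intro)
  show "a *\<^sub>C (r *\<^sub>R x) = r *\<^sub>R (a *\<^sub>C x)" for r and x :: 'a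
    by (simp add: scaleC_scaleC mult.commute flip: scaleC_of_real)
  show "norm (a *\<^sub>C x) \<le> norm x * cmod a" for x :: 'a
    by (simp add: norm_scaleC)
qed (rule scaleC_add_right)

lemmas tendsto_scaleC = bounded_linear.tendsto[OF bounded_linear_scaleC]

lemma norm_add_orthogonal:
  assumes "cinner x y = 0"
  shows "(norm (x + y))\<^sup>2 = (norm x)\<^sup>2 + (norm y)\<^sup>2"
proof -
  have "inner x y = 0" using assms by (simp add: inner_eq_Re_cinner)
  then show ?thesis by (simp add: power2_norm_eq_inner inner_add inner_commute)
qed

section \<open>Subspaces\<close>

lemma csubspace_zero: "csubspace M \<Longrightarrow> 0 \<in> M"
  and csubspace_add: "csubspace M \<Longrightarrow> x \<in> M \<Longrightarrow> y \<in> M \<Longrightarrow> x + y \<in> M"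
  and csubspace_scaleC: "csubspace M \<Longrightarrow> x \<in> M \<Longrightarrow> a *\<^sub>C x \<in> M"
  by (auto simp: csubspace_def)

lemma csubspace_diff: "csubspace M \<Longrightarrow> x \<in> M \<Longrightarrow> y \<in> M \<Longrightarrow> x - y \<in> M"
  using csubspace_add[of M x "- y"] csubspace_scaleC[of M y "-1"] by (simp add: scaleC_minus_one)

lemma csubspace_imp_subspace: "csubspace M \<Longrightarrow> subspace M"
  by (auto simp: csubspace_def subspace_def simp flip: scaleC_of_real)

lemma closed_csubspaceD: "closed_csubspace M \<Longrightarrow> csubspace M" "closed_csubspace M \<Longrightarrow> closed M"
  by (auto simp: closed_csubspace_def)

lemma closed_csubspace_UNIV [simp]: "closed_csubspace UNIV"
  by (auto simp: closed_csubspace_def csubspace_def)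

lemma closed_csubspace_closure:
  assumes "csubspace M"
  shows "closed_csubspace (closure M)"
  unfolding closed_csubspace_def csubspace_def
proof (intro conjI ballI allI)
  show "0 \<in> closure M"
    using csubspace_zero[OF assms] closure_subset by blast
next
  fix x y assume "x \<in> closure M" "y \<in> closure M"
  then obtain f g where "\<And>n. f n \<in> M" "f \<longlonglongrightarrow> x" "\<And>n. g n \<in> M" "g \<longlonglongrightarrow> y"
    by (metis closure_sequential)
  then show "x + y \<in> closure M"
    unfolding closure_sequential using assms
    by (intro exI[of _ "\<lambda>n. f n + g n"]) (auto intro: tendsto_add csubspace_add)
next
  fix a x assume "x \<in> closure M"
  then obtain f where "\<And>n. f n \<in> M" "f \<longlonglongrightarrow> x"
    by (metis closure_sequential)
  then show "a *\<^sub>C x \<in> closure M"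
    unfolding closure_sequential using assms
    by (intro exI[of _ "\<lambda>n. a *\<^sub>C f n"]) (auto intro: tendsto_scaleC csubspace_scaleC)
qed simp

lemma closed_csubspace_ocompl: "closed_csubspace (ocompl M)"
proof -
  have "ocompl M = (\<Inter>y\<in>M. {x. cinner x y = 0})"
    by (auto simp: ocompl_def)
  moreover have "closed {x. cinner x y = 0}" for y :: 'a
    by (intro closed_Collect_eq linear_continuous_on bounded_bilinear.bounded_linear_left
        [OF bounded_bilinear_cinner] continuous_on_const)
  ultimately have "closed (ocompl M)"
    by auto
  then show ?thesis
    by (auto simp: closed_csubspace_def csubspace_def ocompl_def cinner_add_left cinner_scaleC_left)
qed

lemma ocomplD: "x \<in> ocompl M \<Longrightarrow> y \<in> M \<Longrightarrow> cinner x y = 0"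
  by (simp add: ocompl_def)

lemma ocomplD': "x \<in> ocompl M \<Longrightarrow> y \<in> M \<Longrightarrow> cinner y x = 0"
  using cinner_commute[of y x] by (simp add: ocompl_def)

section \<open>Bounded operators\<close>

lemma bounded_ops_into: "T \<in> bounded_ops M N \<Longrightarrow> x \<in> M \<Longrightarrow> T x \<in> N"
  and bounded_ops_add: "T \<in> bounded_ops M N \<Longrightarrow> x \<in> M \<Longrightarrow> y \<in> M \<Longrightarrow> T (x + y) = T x + T y"
  and bounded_ops_scaleC: "T \<in> bounded_ops M N \<Longrightarrow> x \<in> M \<Longrightarrow> T (a *\<^sub>C x) = a *\<^sub>C T x"
  by (auto simp: bounded_ops_def)

lemma bounded_opsI:
  assumes "\<And>x. x \<in> M \<Longrightarrow> T x \<in> N"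
    and "\<And>x y. x \<in> M \<Longrightarrow> y \<in> M \<Longrightarrow> T (x + y) = T x + T y"
    and "\<And>a x. x \<in> M \<Longrightarrow> T (a *\<^sub>C x) = a *\<^sub>C T x"
    and "\<And>x. x \<in> M \<Longrightarrow> norm (T x) \<le> K * norm x"
  shows "T \<in> bounded_ops M N"
  using assms unfolding bounded_ops_def by blast

lemma bounded_ops_bound:
  assumes "T \<in> bounded_ops M N"
  obtains K where "0 \<le> K" "\<And>x. x \<in> M \<Longrightarrow> norm (T x) \<le> K * norm x"
proof -
  obtain K where K: "\<And>x. x \<in> M \<Longrightarrow> norm (T x) \<le> K * norm x"
    using assms unfolding bounded_ops_def by blast
  show ?thesis
  proof (rule that[of "max 0 K"])
    show "norm (T x) \<le> max 0 K * norm x" if "x \<in> M" for x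
      using K[OF that] mult_right_mono[of K "max 0 K" "norm x"] by simp
  qed simp
qed

lemma bounded_ops_diff:
  assumes "T \<in> bounded_ops M N" "csubspace M" "x \<in> M" "y \<in> M"
  shows "T (x - y) = T x - T y"
proof -
  have "T (x + (-1) *\<^sub>C y) = T x + (-1) *\<^sub>C T y"
    using assms by (simp add: bounded_ops_add bounded_ops_scaleC csubspace_scaleC)
  then show ?thesis
    by (simp add: scaleC_minus_one)
qed

lemma bounded_ops_zero: "T \<in> bounded_ops M N \<Longrightarrow> csubspace M \<Longrightarrow> T 0 = 0"
  using bounded_ops_diff[of T M N 0 0] by (simp add: csubspace_zero)

lemma bounded_ops_bounded_linear:
  assumes "T \<in> bounded_ops UNIV N"
  shows "bounded_linear T"
proof -
  obtain K where "0 \<le> K" "\<And>x. norm (T x) \<le> K * norm x"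
    using bounded_ops_bound[OF assms] by (metis UNIV_I)
  then show ?thesis
    using assms by (intro bounded_linear_intro[of T K])
      (auto simp: bounded_ops_add bounded_ops_scaleC mult.commute simp flip: scaleC_of_real)
qed

lemma csubspace_image:
  assumes "T \<in> bounded_ops M N" "csubspace M"
  shows "csubspace (T ` M)"
  unfolding csubspace_def
proof (intro conjI ballI allI)
  show "0 \<in> T ` M"
    using bounded_ops_zero[OF assms] csubspace_zero[OF assms(2)] by (metis imageI)
next
  fix x y assume "x \<in> T ` M" "y \<in> T ` M"
  then show "x + y \<in> T ` M"
    by clarify (metis assms bounded_ops_add csubspace_add imageI)
next
  fix a x assume "x \<in> T ` M"
  then show "a *\<^sub>C x \<in> T ` M"
    by clarify (metis assms bounded_ops_scaleC csubspace_scaleC imageI)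
qed

section \<open>The Riesz representation theorem\<close>

lemma linear_coeff_zero_if_nonneg:
  fixes a b :: real
  assumes "\<And>t. 0 \<le> a * t + b * t\<^sup>2"
  shows "a = 0"
proof (rule ccontr)
  assume "a \<noteq> 0"
  \<comment> \<open>At \<open>t = -a/c\<close> with \<open>c > b\<close> the linear term outweighs the quadratic one.\<close>
  define c where "c = \<bar>b\<bar> + 1"
  have c: "c > 0" "b < c" by (auto simp: c_def)
  have "0 \<le> a * (- a / c) + b * (- a / c)\<^sup>2"
    by (rule assms)
  also have "\<dots> = a\<^sup>2 * (b - c) / c\<^sup>2"
    using c by (simp add: field_simps power2_eq_square)
  also have "\<dots> < 0"
    using c \<open>a \<noteq> 0\<close> by (intro divide_neg_pos mult_pos_neg) auto
  finally show False by simp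
qed

text \<open>The representing vector is the minimiser of \<open>J x = \<parallel>x\<parallel>\<^sup>2 - 2 f x\<close>: by the parallelogram law
  every minimising sequence is Cauchy, and the derivative of \<open>J\<close> vanishes at its limit.  Orthogonal
  projections are obtained from this by representing \<open>z \<mapsto> (z, x)\<close> on the subspace.\<close>

lemma riesz_real:
  fixes f :: "'a::{real_inner,complete_space} \<Rightarrow> real"
  assumes M: "subspace M" "closed M"
    and add: "\<And>x y. x \<in> M \<Longrightarrow> y \<in> M \<Longrightarrow> f (x + y) = f x + f y"
    and scale: "\<And>r x. x \<in> M \<Longrightarrow> f (r *\<^sub>R x) = r * f x"
    and bound: "\<And>x. x \<in> M \<Longrightarrow> \<bar>f x\<bar> \<le> K * norm x"
  obtains u where "u \<in> M" "\<And>x. x \<in> M \<Longrightarrow> f x = inner x u"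
proof -
  define J where "J x = inner x x - 2 * f x" for x
  have lower: "- (K\<^sup>2) \<le> J x" if "x \<in> M" for x
  proof -
    have "0 \<le> (norm x - K)\<^sup>2" by simp
    then show ?thesis
      using bound[OF that] unfolding J_def power2_norm_eq_inner[symmetric] power2_diff
      by (simp add: mult.commute)
  qed
  define m where "m = Inf (J ` M)"
  have bdd: "bdd_below (J ` M)"
    using lower by (intro bdd_belowI2)
  have m_le: "m \<le> J x" if "x \<in> M" for x
    unfolding m_def using that bdd by (intro cInf_lower) auto
  have "\<exists>x\<in>M. J x < m + 1 / real (Suc n)" for n
    using cInf_lessD[of "J ` M" "m + 1 / real (Suc n)"] subspace_0[OF M(1)]
    unfolding m_def by auto
  then obtain x where x: "\<And>n. x n \<in> M" "\<And>n. J (x n) < m + 1 / real (Suc n)"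
    by metis
  have gap: "(norm (y - z))\<^sup>2 \<le> 2 * (J y - m) + 2 * (J z - m)" if "y \<in> M" "z \<in> M" for y z
  proof -
    have mid: "(1/2) *\<^sub>R (y + z) \<in> M"
      using that M(1) by (intro subspace_scale subspace_add)
    have "f ((1/2) *\<^sub>R (y + z)) = (f y + f z) / 2"
      using that M(1) by (simp only: scale add subspace_add)
    then have "(norm (y - z))\<^sup>2 = 2 * J y + 2 * J z - 4 * J ((1/2) *\<^sub>R (y + z))"
      unfolding J_def power2_norm_eq_inner
      by (simp add: inner_add inner_diff inner_commute algebra_simps)
    then show ?thesis using m_le[OF mid] by simp
  qed
  have "Cauchy x"
  proof (rule metric_CauchyI)
    fix e :: real assume "0 < e"
    obtain n0 :: nat where n0: "4 / e\<^sup>2 < real n0"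
      using reals_Archimedean2 by blast
    have "dist (x i) (x j) < e" if "n0 \<le> i" "n0 \<le> j" for i j
    proof -
      have small: "J (x i) - m < e\<^sup>2 / 4" if "n0 \<le> i" for i
      proof -
        have "4 / e\<^sup>2 < real (Suc i)" using n0 that by linarith
        then have "1 / real (Suc i) < e\<^sup>2 / 4"
          using \<open>0 < e\<close> by (simp add: field_simps)
        then show ?thesis using x(2)[of i] by linarith
      qed
      have "(norm (x i - x j))\<^sup>2 \<le> 2 * (J (x i) - m) + 2 * (J (x j) - m)"
        by (rule gap[OF x(1) x(1)])
      also have "\<dots> < 2 * (e\<^sup>2 / 4) + 2 * (e\<^sup>2 / 4)"
        by (intro add_strict_mono mult_strict_left_mono small that) auto
      also have "\<dots> = e\<^sup>2" by simp
      finally have "(norm (x i - x j))\<^sup>2 < e\<^sup>2" .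
      then show ?thesis
        using \<open>0 < e\<close> by (simp add: dist_norm power2_less_imp_less[of _ e])
    qed
    then show "\<exists>M. \<forall>m\<ge>M. \<forall>n\<ge>M. dist (x m) (x n) < e" by blast
  qed
  then obtain u where u: "x \<longlonglongrightarrow> u"
    using Cauchy_convergent_iff convergent_def by blast
  have uM: "u \<in> M"
    using M(2) x(1) u by (rule closed_sequentially)
  have "(\<lambda>n. f (x n)) \<longlonglongrightarrow> f u"
  proof (rule Lim_null_comparison[THEN LIM_zero_cancel])
    have "f (x n) = f (x n - u) + f u" for n
      using add[of "x n - u" u] x(1) uM M(1) by (simp add: subspace_diff)
    then show "\<forall>\<^sub>F n in sequentially. norm (f (x n) - f u) \<le> K * norm (x n - u)"
      using bound x(1) uM M(1) by (simp add: subspace_diff)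
    show "(\<lambda>n. K * norm (x n - u)) \<longlonglongrightarrow> 0"
      by (rule tendsto_mult_right_zero, rule tendsto_norm_zero, rule LIM_zero, rule u)
  qed
  then have lim: "(\<lambda>n. J (x n)) \<longlonglongrightarrow> J u"
    unfolding J_def by (intro tendsto_intros u)
  have "(\<lambda>n. m + 1 / real (Suc n)) \<longlonglongrightarrow> m + 0"
    by (intro tendsto_add tendsto_const LIMSEQ_Suc[OF lim_1_over_n])
  then have "J u \<le> m"
    using LIMSEQ_le[OF lim, of "\<lambda>n. m + 1 / real (Suc n)" m] x(2) by (auto intro: less_imp_le)
  have "f z = inner z u" if z: "z \<in> M" for z
  proof -
    have "0 \<le> (2 * (inner z u - f z)) * t + inner z z * t\<^sup>2" for t
    proof -
      have "u + t *\<^sub>R z \<in> M" using uM z M(1) by (intro subspace_add subspace_scale)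
      then have "J u \<le> J (u + t *\<^sub>R z)"
        using \<open>J u \<le> m\<close> m_le by fastforce
      moreover have "f (u + t *\<^sub>R z) = f u + t * f z"
        using uM z M(1) by (simp add: add scale subspace_scale)
      ultimately show ?thesis
        unfolding J_def by (simp add: inner_add inner_commute algebra_simps power2_eq_square)
    qed
    then have "2 * (inner z u - f z) = 0" by (rule linear_coeff_zero_if_nonneg)
    then show ?thesis by simp
  qed
  then show thesis using that uM by blast
qed

text \<open>The real part of \<open>\<phi>\<close> determines \<open>\<phi>\<close>, because \<open>Im (\<phi> x) = - Re (\<phi> (\<i> x))\<close>.\<close>

lemma riesz:
  fixes \<phi> :: "'a::complex_hilbert \<Rightarrow> complex"
  assumes M: "closed_csubspace M" and \<phi>: "\<phi> \<in> bounded_ops M UNIV"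
  obtains u where "u \<in> M" "\<And>x. x \<in> M \<Longrightarrow> \<phi> x = cinner x u"
proof -
  have sub: "csubspace M" "closed M" using M by (auto simp: closed_csubspace_def)
  obtain K where K: "\<And>x. x \<in> M \<Longrightarrow> norm (\<phi> x) \<le> K * norm x"
    using bounded_ops_bound[OF \<phi>] by metis
  obtain u where u: "u \<in> M" "\<And>x. x \<in> M \<Longrightarrow> Re (\<phi> x) = inner x u"
  proof (rule riesz_real[of M "\<lambda>x. Re (\<phi> x)" K])
    show "Re (\<phi> (r *\<^sub>R x)) = r * Re (\<phi> x)" if "x \<in> M" for r x
      using that \<phi> by (simp add: bounded_ops_scaleC scaleC_complex_def flip: scaleC_of_real)
    show "\<bar>Re (\<phi> x)\<bar> \<le> K * norm x" if "x \<in> M" for x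
      using abs_Re_le_cmod[of "\<phi> x"] K[OF that] by linarith
  qed (use sub \<phi> in \<open>auto simp: bounded_ops_add csubspace_imp_subspace\<close>)
  have "\<phi> x = cinner x u" if "x \<in> M" for x
  proof -
    have "Re (\<phi> (\<i> *\<^sub>C x)) = inner (\<i> *\<^sub>C x) u"
      using u(2) that sub by (simp add: csubspace_scaleC)
    then have "Im (\<phi> x) = Im (cinner x u)"
      using that \<phi> by (simp add: bounded_ops_scaleC scaleC_complex_def inner_eq_Re_cinner cinner_scaleC_left)
    then show ?thesis
      using u(2)[OF that] by (simp add: complex_eq_iff inner_eq_Re_cinner)
  qed
  then show thesis using that u(1) by blast
qed

section \<open>Adjoints\<close>

lemma adj_eqI:
  assumes "csubspace M" "x \<in> M" "\<And>z. z \<in> M \<Longrightarrow> cinner (T z) y = cinner z x"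
  shows "adj M N T y = x"
  unfolding adj_def
proof (rule the_equality)
  fix x' assume x': "x' \<in> M \<and> (\<forall>z\<in>M. cinner (T z) y = cinner z x')"
  then have "cinner (x' - x) (x' - x) = 0"
    using assms csubspace_diff[of M x' x] by (simp add: cinner_diff_right)
  then show "x' = x" by (simp add: cinner_self)
qed (use assms in blast)

context
  fixes M :: "'a::complex_hilbert set" and T :: "'a \<Rightarrow> 'b::complex_inner" and N N' :: "'b set"
  assumes M: "closed_csubspace M" and T: "T \<in> bounded_ops M N'"
begin

lemma adj_into_and_cinner: "adj M N T y \<in> M \<and> (\<forall>z\<in>M. cinner (T z) y = cinner z (adj M N T y))"
proof -
  obtain K where K: "0 \<le> K" "\<And>x. x \<in> M \<Longrightarrow> norm (T x) \<le> K * norm x"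
    using bounded_ops_bound[OF T] by metis
  have "(\<lambda>z. cinner (T z) y) \<in> bounded_ops M UNIV"
  proof (rule bounded_opsI)
    show "norm (cinner (T x) y) \<le> (K * norm y) * norm x" if "x \<in> M" for x
      using cmod_cinner_le[of "T x" y] mult_right_mono[OF K(2)[OF that], of "norm y"]
      by (simp add: algebra_simps)
  qed (use T in \<open>auto simp: bounded_ops_add bounded_ops_scaleC cinner_add_left cinner_scaleC_left
      scaleC_complex_def\<close>)
  then obtain u where "u \<in> M" "\<And>z. z \<in> M \<Longrightarrow> cinner (T z) y = cinner z u"
    using riesz[OF M] by metis
  moreover from this have "adj M N T y = u"
    using M by (intro adj_eqI) (auto simp: closed_csubspace_def)
  ultimately show ?thesis by simp
qed

lemma adj_into: "adj M N T y \<in> M"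
  and cinner_adj: "z \<in> M \<Longrightarrow> cinner (T z) y = cinner z (adj M N T y)"
  using adj_into_and_cinner by auto

lemma adj_add: "adj M N T (x + y) = adj M N T x + adj M N T y"
  using M by (intro adj_eqI)
    (auto simp: cinner_adj cinner_add_right adj_into csubspace_add closed_csubspace_def)

lemma adj_scaleC: "adj M N T (a *\<^sub>C x) = a *\<^sub>C adj M N T x"
  using M by (intro adj_eqI)
    (auto simp: cinner_adj cinner_scaleC_right adj_into csubspace_scaleC closed_csubspace_def)

lemma norm_adj_le:
  assumes "\<And>x. x \<in> M \<Longrightarrow> norm (T x) \<le> K * norm x" "0 \<le> K"
  shows "norm (adj M N T y) \<le> K * norm y"
proof -
  define x where "x = adj M N T y"
  have x: "x \<in> M" by (simp add: x_def adj_into)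
  have "(norm x)\<^sup>2 = cmod (cinner (T x) y)"
    using x by (simp add: cinner_adj x_def[symmetric] cinner_self norm_power)
  also have "\<dots> \<le> (K * norm x) * norm y"
    using cmod_cinner_le[of "T x" y] mult_right_mono[OF assms(1)[OF x], of "norm y"] by simp
  finally have "norm x * norm x \<le> norm x * (K * norm y)"
    by (simp add: power2_eq_square algebra_simps)
  then show ?thesis
    using assms unfolding x_def[symmetric]
    by (cases "x = 0") auto
qed

lemma adj_bounded_ops: "adj M N T \<in> bounded_ops N M"
proof -
  obtain K where "0 \<le> K" "\<And>x. x \<in> M \<Longrightarrow> norm (T x) \<le> K * norm x"
    using bounded_ops_bound[OF T] by metis
  then show ?thesis
    by (intro bounded_opsI[where K = K]) (auto simp: adj_into adj_add adj_scaleC norm_adj_le)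
qed

end

section \<open>Orthogonal projections\<close>

lemma proj_eqI:
  assumes "csubspace M" "p \<in> M" "x - p \<in> ocompl M"
  shows "proj M x = p"
  unfolding proj_def
proof (rule the_equality)
  fix q assume q: "q \<in> M \<and> x - q \<in> ocompl M"
  have "(x - p) - (x - q) \<in> ocompl M"
    using assms q by (intro csubspace_diff[of "ocompl M" "x - p"] closed_csubspaceD closed_csubspace_ocompl) auto
  then have "cinner (q - p) (q - p) = 0"
    using q assms by (intro ocomplD[of _ M]) (auto intro: csubspace_diff)
  then show "q = p" by (simp add: cinner_self)
qed (use assms in auto)

context
  fixes M :: "'a::complex_hilbert set"
  assumes M: "closed_csubspace M"
begin

lemma id_bounded_ops: "(\<lambda>z. z) \<in> bounded_ops M UNIV"
  by (rule bounded_opsI[where K = 1]) auto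

text \<open>The projection is the adjoint of the inclusion map, so linearity and contractivity come from
  the general facts on adjoints.\<close>

lemma proj_eq_adj: "proj M = adj M UNIV (\<lambda>z. z)"
proof
  fix x
  have "x - adj M UNIV (\<lambda>z. z) x \<in> ocompl M"
    unfolding ocompl_def
  proof (clarify)
    fix y assume "y \<in> M"
    then have "cinner y (x - adj M UNIV (\<lambda>z. z) x) = 0"
      using cinner_adj[OF M id_bounded_ops, of y x] by (simp add: cinner_diff_right)
    then show "cinner (x - adj M UNIV (\<lambda>z. z) x) y = 0"
      using cinner_commute by (metis complex_cnj_zero)
  qed
  then show "proj M x = adj M UNIV (\<lambda>z. z) x"
    using M by (intro proj_eqI closed_csubspaceD adj_into[OF M id_bounded_ops])
qed

lemma proj_into: "proj M x \<in> M"
  by (simp add: proj_eq_adj adj_into[OF M id_bounded_ops])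

lemma cinner_proj_right: "z \<in> M \<Longrightarrow> cinner z (proj M x) = cinner z x"
  by (simp add: proj_eq_adj cinner_adj[OF M id_bounded_ops, symmetric])

lemma cinner_proj_left: "z \<in> M \<Longrightarrow> cinner (proj M x) z = cinner x z"
  using cinner_proj_right cinner_commute by metis

lemma proj_bounded_ops: "proj M \<in> bounded_ops UNIV M"
  by (simp add: proj_eq_adj adj_bounded_ops[OF M id_bounded_ops])

lemma proj_add: "proj M (x + y) = proj M x + proj M y"
  and proj_scaleC: "proj M (a *\<^sub>C x) = a *\<^sub>C proj M x"
  using proj_bounded_ops by (auto simp: bounded_ops_add bounded_ops_scaleC)

lemma norm_proj_le: "norm (proj M x) \<le> norm x"
  using norm_adj_le[OF M id_bounded_ops, of 1] by (simp add: proj_eq_adj)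

lemma diff_proj_in_ocompl: "x - proj M x \<in> ocompl M"
  unfolding ocompl_def by (simp add: cinner_diff_left cinner_proj_left)

lemma proj_ident: "x \<in> M \<Longrightarrow> proj M x = x"
  using M by (intro proj_eqI closed_csubspaceD)
    (auto simp: csubspace_zero closed_csubspaceD closed_csubspace_ocompl)

lemma proj_ocompl: "proj (ocompl M) x = x - proj M x"
  by (intro proj_eqI closed_csubspaceD closed_csubspace_ocompl diff_proj_in_ocompl)
    (auto simp: ocompl_def[of "ocompl M"] proj_into ocomplD')

lemma proj_decomp: "x = proj M x + proj (ocompl M) x"
  by (simp add: proj_ocompl)

lemma norm_proj_decomp: "(norm x)\<^sup>2 = (norm (proj M x))\<^sup>2 + (norm (proj (ocompl M) x))\<^sup>2"
  using norm_add_orthogonal[of "proj M x" "proj (ocompl M) x"]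
    ocomplD'[OF _ proj_into] diff_proj_in_ocompl by (simp add: proj_ocompl)

end

section \<open>The nonnegative square root of \<open>I - B\<close>\<close>

text \<open>If \<open>\<parallel>B\<parallel> \<le> 1\<close>, the iteration \<open>Y \<mapsto> (B + Y\<^sup>2)/2\<close> started at \<open>0\<close> tends to a fixed point \<open>Y\<close> with
  \<open>(I - Y)\<^sup>2 = I - B\<close>.  The map need not be a strict contraction, but the increments of the iteration
  are dominated by those of the scalar iteration with \<open>B = 1\<close>, which increases to its limit.\<close>

primrec sqrt_iter :: "('a::banach \<Rightarrow>\<^sub>L 'a) \<Rightarrow> nat \<Rightarrow> 'a \<Rightarrow>\<^sub>L 'a" where
  "sqrt_iter B 0 = 0"
| "sqrt_iter B (Suc n) = (1/2) *\<^sub>R (B + (sqrt_iter B n o\<^sub>L sqrt_iter B n))"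

primrec sqrt_majorant :: "nat \<Rightarrow> real" where
  "sqrt_majorant 0 = 0"
| "sqrt_majorant (Suc n) = (1 + (sqrt_majorant n)\<^sup>2) / 2"

lemma sqrt_majorant_bounds: "0 \<le> sqrt_majorant n \<and> sqrt_majorant n \<le> 1"
  by (induction n) (auto simp: power_le_one)

lemma sqrt_majorant_step: "sqrt_majorant n \<le> sqrt_majorant (Suc n)"
proof -
  have "0 \<le> (sqrt_majorant n - 1)\<^sup>2" by simp
  then show ?thesis by (simp add: power2_eq_square algebra_simps)
qed

lemma Cauchy_sqrt_majorant: "Cauchy sqrt_majorant"
proof -
  have "incseq sqrt_majorant"
    using sqrt_majorant_step by (rule incseq_SucI)
  then have "convergent sqrt_majorant"
    using incseq_convergent[of sqrt_majorant 1] sqrt_majorant_bounds by (metis convergentI)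
  then show ?thesis by (rule convergent_Cauchy)
qed

context
  fixes B :: "'a::banach \<Rightarrow>\<^sub>L 'a"
  assumes B: "norm B \<le> 1"
begin

lemma norm_sqrt_iter_le: "norm (sqrt_iter B n) \<le> sqrt_majorant n"
proof (induction n)
  case (Suc n)
  let ?Y = "sqrt_iter B n"
  have "norm (?Y o\<^sub>L ?Y) \<le> norm ?Y * norm ?Y"
    by (rule norm_blinfun_compose)
  also have "\<dots> \<le> (sqrt_majorant n)\<^sup>2"
    using Suc by (simp add: power2_eq_square mult_mono')
  finally have "norm (B + (?Y o\<^sub>L ?Y)) \<le> 1 + (sqrt_majorant n)\<^sup>2"
    using B norm_triangle_ineq[of B "?Y o\<^sub>L ?Y"] by linarith
  then show ?case by simp
qed simp

text \<open>The majorisation rests on \<open>Z\<^sup>2 - Y\<^sup>2 = Z(Z - Y) + (Z - Y)Y\<close>, which holds without assuming that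
  \<open>Y\<close> and \<open>Z\<close> commute and becomes \<open>b\<^sup>2 - a\<^sup>2 = (b + a)(b - a)\<close> for the scalars.\<close>

lemma norm_sqrt_iter_step_le:
  "norm (sqrt_iter B (Suc n) - sqrt_iter B n) \<le> sqrt_majorant (Suc n) - sqrt_majorant n"
proof (induction n)
  case 0
  then show ?case using B by simp
next
  case (Suc n)
  let ?Y = "sqrt_iter B n" and ?Z = "sqrt_iter B (Suc n)"
  let ?a = "sqrt_majorant n" and ?b = "sqrt_majorant (Suc n)"
  have IH: "norm (?Z - ?Y) \<le> ?b - ?a" by (rule Suc)
  have "(1/2) *\<^sub>R (B + (Z o\<^sub>L Z)) - (1/2) *\<^sub>R (B + (Y o\<^sub>L Y))
      = (1/2) *\<^sub>R ((Z o\<^sub>L (Z - Y)) + ((Z - Y) o\<^sub>L Y))" for Y Z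
    by (rule blinfun_eqI) (simp add: blinfun.bilinear_simps algebra_simps)
  from this[of ?Z ?Y]
  have eq: "sqrt_iter B (Suc (Suc n)) - ?Z = (1/2) *\<^sub>R ((?Z o\<^sub>L (?Z - ?Y)) + ((?Z - ?Y) o\<^sub>L ?Y))"
    by (simp only: sqrt_iter.simps(2))
  have 1: "norm (?Z o\<^sub>L (?Z - ?Y)) \<le> ?b * (?b - ?a)"
    by (rule order_trans[OF norm_blinfun_compose mult_mono'[OF norm_sqrt_iter_le IH]]) simp_all
  have 2: "norm ((?Z - ?Y) o\<^sub>L ?Y) \<le> (?b - ?a) * ?a"
    by (rule order_trans[OF norm_blinfun_compose mult_mono'[OF IH norm_sqrt_iter_le]]) simp_all
  have "norm ((?Z o\<^sub>L (?Z - ?Y)) + ((?Z - ?Y) o\<^sub>L ?Y)) \<le> ?b * (?b - ?a) + (?b - ?a) * ?a"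
    by (rule order_trans[OF norm_triangle_ineq]) (rule add_mono[OF 1 2])
  also have "\<dots> = 2 * (sqrt_majorant (Suc (Suc n)) - ?b)"
    unfolding sqrt_majorant.simps(2)[of "Suc n"] sqrt_majorant.simps(2)[of n]
    by (simp add: power2_eq_square field_simps)
  finally show ?case
    unfolding eq norm_scaleR by (simp del: sqrt_iter.simps sqrt_majorant.simps)
qed

lemma convergent_sqrt_iter: "convergent (sqrt_iter B)"
proof -
  have dist_le: "dist (sqrt_iter B m) (sqrt_iter B n) \<le> dist (sqrt_majorant m) (sqrt_majorant n)"
    for m n
  proof (induction m n rule: linorder_wlog)
    case (le m n)
    have "norm (sqrt_iter B n - sqrt_iter B m) \<le> sqrt_majorant n - sqrt_majorant m"
      using le
    proof (induction n rule: dec_induct)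
      case (step n)
      then show ?case
        using norm_sqrt_iter_step_le[of n]
          norm_triangle_ineq[of "sqrt_iter B (Suc n) - sqrt_iter B n" "sqrt_iter B n - sqrt_iter B m"]
        by (simp del: sqrt_iter.simps sqrt_majorant.simps)
    qed simp
    then show ?case
      by (simp add: dist_norm norm_minus_commute)
  qed (simp add: dist_commute)
  have "Cauchy (sqrt_iter B)"
    using Cauchy_sqrt_majorant dist_le unfolding Cauchy_def by (meson order_le_less_trans)
  then show ?thesis by (simp add: Cauchy_convergent)
qed

definition sqrt_limit :: "'a \<Rightarrow>\<^sub>L 'a" where
  "sqrt_limit = lim (sqrt_iter B)"

lemma sqrt_iter_tendsto: "sqrt_iter B \<longlonglongrightarrow> sqrt_limit"
  using convergent_sqrt_iter by (simp add: sqrt_limit_def convergent_LIMSEQ_iff)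

lemma sqrt_iter_apply_tendsto: "f \<longlonglongrightarrow> x \<Longrightarrow> (\<lambda>n. blinfun_apply (sqrt_iter B n) (f n)) \<longlonglongrightarrow> sqrt_limit x"
  by (intro blinfun.tendsto sqrt_iter_tendsto)

lemma norm_sqrt_limit_le: "norm (sqrt_limit x) \<le> norm x"
proof -
  have "norm sqrt_limit \<le> 1"
    using norm_sqrt_iter_le sqrt_majorant_bounds
    by (intro LIMSEQ_le_const2[OF tendsto_norm[OF sqrt_iter_tendsto]]) (meson order_trans)
  then show ?thesis
    using norm_blinfun[of sqrt_limit x] mult_right_mono[of "norm sqrt_limit" 1 "norm x"] by simp
qed

lemma sqrt_limit_fixed_point: "2 *\<^sub>R sqrt_limit x = B x + sqrt_limit (sqrt_limit x)"
proof -
  have "(\<lambda>n. 2 *\<^sub>R blinfun_apply (sqrt_iter B (Suc n)) x) \<longlonglongrightarrow> 2 *\<^sub>R sqrt_limit x"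
    by (intro tendsto_scaleR tendsto_const LIMSEQ_Suc[OF sqrt_iter_apply_tendsto])
  moreover have "(\<lambda>n. B x + blinfun_apply (sqrt_iter B n) (blinfun_apply (sqrt_iter B n) x))
      \<longlonglongrightarrow> B x + sqrt_limit (sqrt_limit x)"
    by (intro tendsto_add tendsto_const sqrt_iter_apply_tendsto)
  moreover have "2 *\<^sub>R blinfun_apply (sqrt_iter B (Suc n)) x
      = B x + blinfun_apply (sqrt_iter B n) (blinfun_apply (sqrt_iter B n) x)" for n
    by (simp add: blinfun.bilinear_simps)
  ultimately show ?thesis
    using LIMSEQ_unique by simp
qed

text \<open>Applied to multiplication by a complex scalar, this gives complex linearity of the limit;
  applied to another square root, it gives the commutation that uniqueness needs.\<close>

lemma sqrt_limit_commutes: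
  assumes f: "bounded_linear f" and "\<And>x. f (B x) = B (f x)"
  shows "f (sqrt_limit x) = sqrt_limit (f x)"
proof -
  have "f (blinfun_apply (sqrt_iter B n) x) = blinfun_apply (sqrt_iter B n) (f x)" for n x
    by (induction n arbitrary: x)
      (simp_all add: blinfun.bilinear_simps assms linear_simps[OF f] )
  moreover have "(\<lambda>n. f (blinfun_apply (sqrt_iter B n) x)) \<longlonglongrightarrow> f (sqrt_limit x)"
    by (intro bounded_linear.tendsto[OF f] sqrt_iter_apply_tendsto tendsto_const)
  moreover have "(\<lambda>n. blinfun_apply (sqrt_iter B n) (f x)) \<longlonglongrightarrow> sqrt_limit (f x)"
    by (intro sqrt_iter_apply_tendsto tendsto_const)
  ultimately show ?thesis
    using LIMSEQ_unique by simp
qed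

end

lemma sqrt_limit_symmetric:
  fixes B :: "'a::{real_inner,banach} \<Rightarrow>\<^sub>L 'a"
  assumes B: "norm B \<le> 1" and sym: "\<And>x y. inner (B x) y = inner x (B y)"
  shows "inner (sqrt_limit B x) y = inner x (sqrt_limit B y)"
proof -
  have "inner (blinfun_apply (sqrt_iter B n) x) y = inner x (blinfun_apply (sqrt_iter B n) y)" for n x y
    by (induction n arbitrary: x y)
      (simp_all add: blinfun.bilinear_simps sym inner_add_left inner_add_right)
  moreover have "(\<lambda>n. inner (blinfun_apply (sqrt_iter B n) x) y) \<longlonglongrightarrow> inner (sqrt_limit B x) y"
    by (intro tendsto_inner sqrt_iter_apply_tendsto[OF B] tendsto_const)
  moreover have "(\<lambda>n. inner x (blinfun_apply (sqrt_iter B n) y)) \<longlonglongrightarrow> inner x (sqrt_limit B y)"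
    by (intro tendsto_inner sqrt_iter_apply_tendsto[OF B] tendsto_const)
  ultimately show ?thesis
    using LIMSEQ_unique by simp
qed

text \<open>Polarisation: the form \<open>(R z, z)\<close> is real at \<open>z = x + y\<close> and at \<open>z = \<i> x + y\<close>.\<close>

lemma nonneg_op_selfadjoint:
  assumes "nonneg_op UNIV R"
  shows "cinner (R x) y = cinner x (R y)"
proof -
  have R: "R \<in> bounded_ops UNIV UNIV" and "Im (cinner (R z) z) = 0" for z
    using assms by (auto simp: nonneg_op_def complex_nonneg_Reals_iff)
  note im = this(2)
  have "Im (cinner (R x) y) + Im (cinner (R y) x) = 0"
    using im[of "x + y"] im[of x] im[of y] R
    by (simp add: bounded_ops_add cinner_add_left cinner_add_right)
  moreover have "Re (cinner (R x) y) = Re (cinner (R y) x)"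
    using im[of "\<i> *\<^sub>C x + y"] im[of x] im[of y] R
    by (simp add: bounded_ops_add bounded_ops_scaleC cinner_add_left cinner_add_right
        cinner_scaleC_left cinner_scaleC_right)
  ultimately have "cinner (R x) y = cnj (cinner (R y) x)"
    by (simp add: complex_eq_iff)
  then show ?thesis
    using cinner_commute by metis
qed

text \<open>The quadratic polynomial \<open>t \<mapsto> (R(y + tRy), y + tRy)\<close> is nonnegative and has no constant term,
  so its linear coefficient \<open>2\<parallel>Ry\<parallel>\<^sup>2\<close> vanishes.\<close>

lemma nonneg_op_zero_form:
  assumes "nonneg_op UNIV R" "cinner (R y) y = 0"
  shows "R y = 0"
proof -
  have R: "R \<in> bounded_ops UNIV UNIV" and nonneg: "0 \<le> Re (cinner (R z) z)" for z
    using assms by (auto simp: nonneg_op_def complex_nonneg_Reals_iff)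
  interpret bounded_linear R using R by (rule bounded_ops_bounded_linear)
  have "0 \<le> (2 * inner (R y) (R y)) * t + inner (R (R y)) (R y) * t\<^sup>2" for t
  proof -
    have "inner (R (R y)) y = inner (R y) (R y)"
      using nonneg_op_selfadjoint[OF assms(1), of "R y" y] by (simp add: inner_eq_Re_cinner)
    moreover have "inner (R y) y = 0"
      using assms(2) by (simp add: inner_eq_Re_cinner)
    ultimately show ?thesis
      using nonneg[of "y + t *\<^sub>R R y"] unfolding inner_eq_Re_cinner[symmetric]
      by (simp add: add scaleR inner_add power2_eq_square algebra_simps)
  qed
  then have "2 * inner (R y) (R y) = 0" by (rule linear_coeff_zero_if_nonneg)
  then show ?thesis by simp
qed

text \<open>For \<open>y = (R - R')x\<close> one has \<open>(R + R')y = R\<^sup>2x - R'\<^sup>2x = 0\<close>.  Both forms are nonnegative at \<open>y\<close>, so \<open>Ry\<close> and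
  \<open>R'y\<close> vanish, and \<open>\<parallel>y\<parallel>\<^sup>2 = (x, (R - R')y)\<close>.\<close>

lemma commuting_sqrt_unique:
  assumes R: "nonneg_op UNIV R" and R': "nonneg_op UNIV R'"
    and sq: "\<And>x. R (R x) = R' (R' x)" and comm: "\<And>x. R (R' x) = R' (R x)"
  shows "R = R'"
proof
  fix x
  have lin: "R \<in> bounded_ops UNIV UNIV" "R' \<in> bounded_ops UNIV UNIV"
    using R R' by (auto simp: nonneg_op_def)
  have diff: "R (u - v) = R u - R v" "R' (u - v) = R' u - R' v" for u v
    using lin by (auto intro!: bounded_ops_diff closed_csubspaceD)
  define y where "y = R x - R' x"
  have "R y + R' y = 0"
    by (simp add: y_def diff sq comm)
  then have "cinner (R y) y + cinner (R' y) y = 0"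
    by (simp flip: cinner_add_left)
  moreover have "cinner (R y) y \<in> \<real>\<^sub>\<ge>\<^sub>0" "cinner (R' y) y \<in> \<real>\<^sub>\<ge>\<^sub>0"
    using R R' by (auto simp: nonneg_op_def)
  ultimately have "cinner (R y) y = 0" "cinner (R' y) y = 0"
    by (auto simp: complex_nonneg_Reals_iff complex_eq_iff)
  then have "R y = 0" "R' y = 0"
    using R R' by (auto intro: nonneg_op_zero_form)
  moreover have "cinner y y = cinner x (R y) - cinner x (R' y)"
    using nonneg_op_selfadjoint[OF R] nonneg_op_selfadjoint[OF R']
    by (metis cinner_diff_left y_def)
  ultimately have "cinner y y = 0" by simp
  then show "R x = R' x" by (simp add: cinner_self y_def)
qed

instance complex_hilbert \<subseteq> banach ..

text \<open>The root is \<open>R = I - Y\<close> with \<open>Y\<close> the limit of the iteration; it is nonnegative since \<open>Y\<close> is a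
  self-adjoint contraction.  A competing root commutes with its square, hence with \<open>B\<close>, \<open>Y\<close> and \<open>R\<close>.\<close>

lemma sqrt_op_spec:
  fixes B :: "'a::complex_hilbert \<Rightarrow> 'a"
  assumes B: "contraction UNIV UNIV B" and sym: "\<And>x y. cinner (B x) y = cinner x (B y)"
  shows "nonneg_op UNIV (sqrt_op UNIV (\<lambda>x. x - B x)) \<and>
    (\<forall>x. sqrt_op UNIV (\<lambda>x. x - B x) (sqrt_op UNIV (\<lambda>x. x - B x) x) = x - B x)"
proof -
  have Bop: "B \<in> bounded_ops UNIV UNIV" and Bn: "norm (B x) \<le> norm x" for x
    using B by (auto simp: contraction_def)
  define b where "b = Blinfun B"
  have b [simp]: "blinfun_apply b = B"
    using bounded_ops_bounded_linear[OF Bop] by (simp add: b_def bounded_linear_Blinfun_apply)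
  have norm_b: "norm b \<le> 1"
    by (rule norm_blinfun_bound) (use Bn in auto)
  define Y where "Y = blinfun_apply (sqrt_limit b)"
  have Y_comm: "f (Y x) = Y (f x)" if "bounded_linear f" "\<And>x. f (B x) = B (f x)" for f x
    unfolding Y_def using that by (intro sqrt_limit_commutes norm_b) auto
  have Y_scale: "Y (a *\<^sub>C x) = a *\<^sub>C Y x" for a x
    using Y_comm[OF bounded_linear_scaleC, of a x] Bop by (simp add: bounded_ops_scaleC)
  have Y_add: "Y (x + y) = Y x + Y y" and Y_diff: "Y (x - y) = Y x - Y y" for x y
    by (simp_all add: Y_def blinfun.bilinear_simps)
  have Y_norm: "norm (Y x) \<le> norm x" for x
    unfolding Y_def by (rule norm_sqrt_limit_le[OF norm_b])
  have Y_fix: "2 *\<^sub>R Y x = B x + Y (Y x)" for x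
    unfolding Y_def using sqrt_limit_fixed_point[OF norm_b, of x] by simp
  have Y_inner: "inner (Y x) y = inner x (Y y)" for x y
    unfolding Y_def by (rule sqrt_limit_symmetric[OF norm_b]) (simp add: inner_eq_Re_cinner sym)
  define R where "R x = x - Y x" for x
  have R_op: "R \<in> bounded_ops UNIV UNIV"
  proof (rule bounded_opsI)
    show "R (a *\<^sub>C x) = a *\<^sub>C R x" for a x
      using scaleC_add_right[of a x "- Y x"]
      by (simp add: R_def Y_scale bounded_linear.linear[OF bounded_linear_scaleC] linear_diff)
    show "norm (R x) \<le> 2 * norm x" for x
      unfolding R_def using norm_triangle_ineq4[of x "Y x"] Y_norm[of x] by linarith
  qed (auto simp: R_def Y_add)
  have R_nonneg: "nonneg_op UNIV R"
    unfolding nonneg_op_def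
  proof (intro conjI ballI R_op)
    fix x
    \<comment> \<open>\<open>Y\<close> is known to be symmetric for the real inner product only; this makes the form real.\<close>
    have "Im (cinner (Y x) x) = inner x (Y (\<i> *\<^sub>C x))"
      by (simp add: Im_cinner Y_inner)
    also have "\<dots> = - Im (cinner (Y x) x)"
      using arg_cong[OF cinner_commute[of x "Y x"], of Im] by (simp add: Y_scale flip: Im_cinner)
    finally have "Im (cinner (Y x) x) = 0" by simp
    moreover have "Re (cinner (Y x) x) \<le> (norm x)\<^sup>2"
      using norm_cauchy_schwarz[of "Y x" x] mult_right_mono[OF Y_norm[of x], of "norm x"]
      by (simp add: inner_eq_Re_cinner power2_eq_square)
    ultimately show "cinner (R x) x \<in> \<real>\<^sub>\<ge>\<^sub>0"
      by (simp add: R_def cinner_diff_left cinner_self complex_nonneg_Reals_iff del: of_real_power)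
  qed
  have R_sq: "R (R x) = x - B x" for x
    using Y_fix[of x] by (simp add: R_def Y_diff scaleR_2 algebra_simps)
  have "sqrt_op UNIV (\<lambda>x. x - B x) = R"
    unfolding sqrt_op_def
  proof (rule the_equality)
    fix R' assume R': "R' \<in> extensional UNIV \<and> nonneg_op UNIV R' \<and> (\<forall>x\<in>UNIV. R' (R' x) = x - B x)"
    then have lin: "bounded_linear R'"
      by (auto simp: nonneg_op_def intro: bounded_ops_bounded_linear)
    have sq: "R' (R' x) = x - B x" for x using R' by auto
    have "R' (B x) = B (R' x)" for x
    proof -
      have "R' (x - B x) = R' x - B (R' x)"
        by (metis sq)
      then show ?thesis by (simp add: linear_simps[OF lin])
    qed
    then have "R' (R x) = R (R' x)" for x
      by (simp add: R_def linear_simps[OF lin] Y_comm[OF lin])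
    then show "R' = R"
      using R' R_nonneg sq R_sq by (intro commuting_sqrt_unique) auto
  qed (use R_nonneg R_sq in auto)
  then show ?thesis using R_nonneg R_sq by simp
qed

section \<open>Factorisation through the closure of a range\<close>

lemma bounded_ops_continuous_on:
  assumes T: "T \<in> bounded_ops M N" and M: "csubspace M"
  shows "continuous_on M T"
proof -
  obtain K where K: "0 \<le> K" "\<And>x. x \<in> M \<Longrightarrow> norm (T x) \<le> K * norm x"
    using bounded_ops_bound[OF T] by metis
  have "K-lipschitz_on M T"
    using K M by (intro lipschitz_onI)
      (auto simp: dist_norm csubspace_diff simp flip: bounded_ops_diff[OF T])
  then show ?thesis by (rule lipschitz_on_continuous_on)
qed

text \<open>If \<open>A\<close> is dominated by \<open>D\<close>, then \<open>D x \<mapsto> A x\<close> is well defined and Lipschitz on the range of \<open>D\<close>, so it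
  extends to the closure.  The operator \<open>X\<^sub>0\<close> is constructed in this way.\<close>

lemma factor_through:
  fixes D :: "'a::complex_inner \<Rightarrow> 'b::complex_inner" and A :: "'a \<Rightarrow> 'c::complex_hilbert"
  assumes M: "csubspace M" and D: "D \<in> bounded_ops M UNIV" and A: "A \<in> bounded_ops M N"
    and N: "closed N" and le: "\<And>x. x \<in> M \<Longrightarrow> norm (A x) \<le> K * norm (D x)" and K: "0 \<le> K"
  obtains X where "X \<in> bounded_ops (closure (D ` M)) N"
    and "\<And>x. x \<in> M \<Longrightarrow> X (D x) = A x"
    and "\<And>z. z \<in> closure (D ` M) \<Longrightarrow> norm (X z) \<le> K * norm z"
proof -
  define f where "f z = A (inv_into M D z)" for z
  have fD: "f (D x) = A x" if x: "x \<in> M" for x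
  proof -
    define x' where "x' = inv_into M D (D x)"
    have x': "x' \<in> M" "D x' = D x"
      using x by (auto simp: x'_def inv_into_into f_inv_into_f)
    have "norm (A (x' - x)) \<le> K * norm (D (x' - x))"
      using M x x' by (intro le csubspace_diff)
    then show ?thesis
      using x x' M A D by (simp add: f_def bounded_ops_diff flip: x'_def)
  qed
  have lip: "K-lipschitz_on (D ` M) f"
  proof (rule lipschitz_onI[OF _ K], clarify)
    fix x y assume "x \<in> M" "y \<in> M"
    then show "dist (f (D x)) (f (D y)) \<le> K * dist (D x) (D y)"
      using le[of "x - y"] M A D
      by (simp add: fD dist_norm bounded_ops_diff[symmetric] csubspace_diff)
  qed
  obtain X where X: "uniformly_continuous_on (closure (D ` M)) X" "\<And>z. z \<in> D ` M \<Longrightarrow> f z = X z"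
    using uniformly_continuous_on_extension_on_closure[OF lipschitz_on_uniformly_continuous[OF lip]]
    by metis
  have cont: "continuous_on (closure (D ` M)) X"
    using X(1) by (rule uniformly_continuous_imp_continuous)
  have XD: "X (D x) = A x" if "x \<in> M" for x
    using X(2)[of "D x"] fD that by simp
  have seq: "\<exists>s. (\<forall>n. s n \<in> M) \<and> (\<lambda>n. D (s n)) \<longlonglongrightarrow> z \<and> (\<lambda>n. A (s n)) \<longlonglongrightarrow> X z"
    if z: "z \<in> closure (D ` M)" for z
  proof -
    obtain t where t: "\<And>n. t n \<in> D ` M" "t \<longlonglongrightarrow> z"
      using z by (metis closure_sequential)
    obtain s where s: "\<And>n. s n \<in> M" "\<And>n. t n = D (s n)"
      using t(1) unfolding image_iff by metis
    have "(\<lambda>n. X (t n)) \<longlonglongrightarrow> X z"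
      using t(1) closure_subset
      by (intro continuous_on_tendsto_compose[OF cont t(2) z] always_eventually allI) blast
    then show ?thesis
      using t(2) s(1) unfolding s(2) by (intro exI[of _ s]) (simp add: XD)
  qed
  note cl = closed_csubspaceD(1)[OF closed_csubspace_closure[OF csubspace_image[OF D M]]]
  have XI: "X z = w" if "\<And>n. s n \<in> M" "(\<lambda>n. D (s n)) \<longlonglongrightarrow> z" "(\<lambda>n. A (s n)) \<longlonglongrightarrow> w"
    "z \<in> closure (D ` M)" for s z w
  proof -
    have "(\<lambda>n. X (D (s n))) \<longlonglongrightarrow> X z"
      using that(1) closure_subset
      by (intro continuous_on_tendsto_compose[OF cont that(2,4)] always_eventually allI) blast
    then show ?thesis
      using that LIMSEQ_unique by (simp add: XD)
  qed
  have bound: "norm (X z) \<le> K * norm z" if z: "z \<in> closure (D ` M)" for z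
  proof -
    obtain s where s: "\<And>n. s n \<in> M" "(\<lambda>n. D (s n)) \<longlonglongrightarrow> z" "(\<lambda>n. A (s n)) \<longlonglongrightarrow> X z"
      using seq[OF z] by blast
    show ?thesis
      by (rule LIMSEQ_le[OF tendsto_norm[OF s(3)] tendsto_mult[OF tendsto_const tendsto_norm[OF s(2)]]])
        (use le s(1) in blast)
  qed
  have "X \<in> bounded_ops (closure (D ` M)) N"
  proof (rule bounded_opsI[OF _ _ _ bound])
    fix z assume z: "z \<in> closure (D ` M)"
    then obtain s where s: "\<And>n. s n \<in> M" "(\<lambda>n. D (s n)) \<longlonglongrightarrow> z" "(\<lambda>n. A (s n)) \<longlonglongrightarrow> X z"
      using seq by blast
    show "X z \<in> N"
      using s A by (intro closed_sequentially[OF N _ s(3)]) (auto intro: bounded_ops_into)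
    show "X (a *\<^sub>C z) = a *\<^sub>C X z" for a
      using s z M D A cl
      by (intro XI[where s = "\<lambda>n. a *\<^sub>C s n"])
        (auto simp: bounded_ops_scaleC csubspace_scaleC intro!: tendsto_scaleC)
    fix z' assume z': "z' \<in> closure (D ` M)"
    then obtain s' where s': "\<And>n. s' n \<in> M" "(\<lambda>n. D (s' n)) \<longlonglongrightarrow> z'" "(\<lambda>n. A (s' n)) \<longlonglongrightarrow> X z'"
      using seq by blast
    show "X (z + z') = X z + X z'"
      using s s' z z' M D A cl
      by (intro XI[where s = "\<lambda>n. s n + s' n"])
        (auto simp: bounded_ops_add csubspace_add intro!: tendsto_add)
  qed
  then show thesis using that XD bound by blast
qed

text \<open>A form of Douglas' range inclusion lemma for functionals: \<open>(x, w)\<close> factors as \<open>(D x, u)\<close> for some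
  \<open>u\<close> in the closure of the range, and then \<open>w = D u\<close>.\<close>

lemma in_range_if_majorised:
  fixes D :: "'a::complex_hilbert \<Rightarrow> 'a"
  assumes D: "D \<in> bounded_ops UNIV UNIV" and sym: "\<And>x y. cinner (D x) y = cinner x (D y)"
    and le: "\<And>x. cmod (cinner x w) \<le> K * norm (D x)" and K: "0 \<le> K"
  shows "w \<in> range D"
proof -
  have "(\<lambda>x. cinner x w) \<in> bounded_ops UNIV UNIV"
    by (rule bounded_opsI[where K = "norm w"])
      (auto simp: cinner_add_left cinner_scaleC_left scaleC_complex_def cmod_cinner_le mult.commute
        intro: order_trans[OF cmod_cinner_le])
  then obtain X where X: "X \<in> bounded_ops (closure (range D)) UNIV" "\<And>x. X (D x) = cinner x w"
    by (rule factor_through[OF closed_csubspaceD(1)[OF closed_csubspace_UNIV] D _ closed_UNIV le K]) auto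
  obtain u where u: "\<And>z. z \<in> closure (range D) \<Longrightarrow> X z = cinner z u"
    using riesz[OF closed_csubspace_closure[OF csubspace_image[OF D closed_csubspaceD(1)[OF closed_csubspace_UNIV]]] X(1)]
    by blast
  have "cinner x w = cinner x (D u)" for x
    using X(2)[of x] u[of "D x"] closure_subset[of "range D"] by (auto simp: sym)
  then have "w = D u" by (rule cinner_extensionality)
  then show ?thesis by simp
qed

section \<open>Conjugations\<close>

lemma cinner_conjugation:
  assumes C: "conjugation C"
  shows "cinner (C x) (C y) = cinner y x"
proof -
  have add: "C (x + y) = C x + C y" and scale: "C (a *\<^sub>C x) = cnj a *\<^sub>C C x"
    and norm: "norm (C x) = norm x" for a x y
    using C by (auto simp: conjugation_def)
  have re: "inner (C x) (C y) = inner x y" for x y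
    using norm[of "x + y"] norm[of x] norm[of y]
    by (simp add: add norm_eq_sqrt_inner inner_add inner_commute)
  have "Im (cinner (C x) (C y)) = inner (C x) (\<i> *\<^sub>C C y)"
    by (rule Im_cinner)
  also have "\<dots> = inner (C x) (C ((- \<i>) *\<^sub>C y))"
    by (simp add: scale)
  also have "\<dots> = - Im (cinner x y)"
    unfolding re by (simp add: inner_eq_Re_cinner cinner_scaleC_right)
  finally have "cinner (C x) (C y) = cnj (cinner x y)"
    using re[of x y] by (simp add: complex_eq_iff inner_eq_Re_cinner)
  then show ?thesis
    using cinner_commute by metis
qed

section \<open>The extension determined by \<open>X\<^sub>0\<close>\<close>

locale symmetric_contraction =
  fixes C V :: "'a::complex_hilbert \<Rightarrow> 'a" and S :: "'a set"
  assumes conj: "conjugation C"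
    and S: "closed_csubspace S"
    and V: "contraction S UNIV V"
    and C_sym: "C_symmetric C S V"
begin

abbreviation Vs where "Vs \<equiv> adj S UNIV V"
abbreviation D where "D \<equiv> D_Vstar S V"
abbreviation L where "L \<equiv> L0 C S V"
abbreviation X where "X \<equiv> X0 C S V"
abbreviation Xs where "Xs \<equiv> X0_star C S V"
abbreviation Xt where "Xt \<equiv> X0_tilde C S V"
abbreviation Vt where "Vt \<equiv> V_tilde C S V"
abbreviation P where "P \<equiv> proj S"
abbreviation Q where "Q \<equiv> proj (ocompl S)"

lemma C_add: "C (x + y) = C x + C y"
  and C_scaleC: "C (a *\<^sub>C x) = cnj a *\<^sub>C C x"
  and norm_C [simp]: "norm (C x) = norm x"
  and C_C [simp]: "C (C x) = x"
  using conj by (auto simp: conjugation_def)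

lemma C_diff: "C (x - y) = C x - C y"
  using C_add[of "x - y" y] by (simp add: algebra_simps)

lemma C_zero [simp]: "C 0 = 0"
  using C_diff[of 0 0] by simp

lemma cinner_C: "cinner (C x) (C y) = cinner y x"
  using conj by (rule cinner_conjugation)

lemma cinner_C_left: "cinner (C x) y = cinner (C y) x"
  using cinner_C[of x "C y"] by simp

lemma cinner_C_right: "cinner x (C y) = cinner y (C x)"
  using cinner_C[of "C x" y] by simp

lemma sub: "csubspace S"
  using S by (rule closed_csubspaceD)

lemma V_ops: "V \<in> bounded_ops S UNIV" and V_norm: "x \<in> S \<Longrightarrow> norm (V x) \<le> norm x"
  using V by (auto simp: contraction_def)

lemmas V_add = bounded_ops_add[OF V_ops]
lemmas V_scaleC = bounded_ops_scaleC[OF V_ops]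
lemmas P_into = proj_into[OF S]
lemmas Vs_into = adj_into[OF S V_ops, of UNIV]
lemmas cinner_V = cinner_adj[OF S V_ops, of _ _ UNIV]
lemmas Vs_add = adj_add[OF S V_ops, of UNIV]
lemmas Vs_scaleC = adj_scaleC[OF S V_ops, of UNIV]

lemma Vs_norm: "norm (Vs x) \<le> norm x"
  using norm_adj_le[OF S V_ops, of 1 UNIV] V_norm by simp

lemmas Q_into = proj_into[OF closed_csubspace_ocompl]

lemma cinner_Vs: "y \<in> S \<Longrightarrow> cinner (Vs x) y = cinner x (V y)"
  using cinner_V[of y x] cinner_commute by metis

lemma cinner_C_V: "f \<in> S \<Longrightarrow> g \<in> S \<Longrightarrow> cinner (V f) (C g) = cinner f (C (V g))"
  using C_sym by (auto simp: C_symmetric_def)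

lemma Vs_C: assumes "h \<in> S" shows "Vs (C h) = P (C (V h))"
  by (rule adj_eqI[OF sub P_into]) (simp add: cinner_C_V cinner_proj_right[OF S] assms)

lemma adj_Vs: "y \<in> S \<Longrightarrow> adj UNIV S Vs y = V y"
  by (rule adj_eqI) (simp_all add: closed_csubspaceD cinner_Vs)

lemma D_eq: "D = sqrt_op UNIV (\<lambda>x. x - V (Vs x))"
  by (simp add: D_Vstar_def defect_op_def adj_Vs Vs_into)

lemma D_spec: "nonneg_op UNIV D" "D (D x) = x - V (Vs x)"
proof -
  have "V (Vs x) \<in> UNIV" "norm (V (Vs x)) \<le> norm x" for x
    using V_norm[OF Vs_into, of x] Vs_norm[of x] by auto
  then have "contraction UNIV UNIV (\<lambda>x. V (Vs x))"
    unfolding contraction_def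
    by (intro conjI bounded_opsI[where K = 1])
      (simp_all add: Vs_add V_add Vs_scaleC V_scaleC Vs_into)
  moreover have "cinner (V (Vs x)) y = cinner x (V (Vs y))" for x y
    by (simp add: cinner_V Vs_into flip: cinner_Vs)
  ultimately show "nonneg_op UNIV D" "D (D x) = x - V (Vs x)"
    using sqrt_op_spec[of "\<lambda>x. V (Vs x)"] by (auto simp: D_eq)
qed

lemma D_ops: "D \<in> bounded_ops UNIV UNIV"
  using D_spec(1) by (simp add: nonneg_op_def)

lemma cinner_D: "cinner (D x) y = cinner x (D y)"
  using D_spec(1) by (rule nonneg_op_selfadjoint)

lemma D_add: "D (x + y) = D x + D y" and D_scaleC: "D (a *\<^sub>C x) = a *\<^sub>C D x"
  using D_ops by (auto simp: bounded_ops_add bounded_ops_scaleC)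

lemma D_zero: "D 0 = 0"
  using bounded_ops_zero[OF D_ops] by (simp add: closed_csubspaceD)

lemma norm_D: "(norm (D x))\<^sup>2 + (norm (Vs x))\<^sup>2 = (norm x)\<^sup>2"
proof -
  have "complex_of_real ((norm (D x))\<^sup>2) = cinner x x - cinner x (V (Vs x))"
    by (simp only: cinner_self[symmetric] cinner_D D_spec cinner_diff_right)
  also have "\<dots> = complex_of_real ((norm x)\<^sup>2) - complex_of_real ((norm (Vs x))\<^sup>2)"
    by (simp only: cinner_self[symmetric] cinner_Vs[OF Vs_into, symmetric])
  finally show ?thesis
    unfolding of_real_diff[symmetric] of_real_eq_iff by simp
qed

lemma norm_D_le: "norm (D x) \<le> norm x"
  using norm_D[of x] by (metis le_add_same_cancel1 norm_ge_zero power2_le_imp_le zero_le_power2)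

text \<open>The row operator \<open>(V, D)\<close> is a contraction because its adjoint \<open>x \<mapsto> (V\<^sup>*x, Dx)\<close> is an isometry.\<close>

lemma norm_row_le:
  assumes "f \<in> S"
  shows "(norm (V f + D u))\<^sup>2 \<le> (norm f)\<^sup>2 + (norm u)\<^sup>2"
proof -
  define y where "y = V f + D u"
  have "(norm y)\<^sup>2 = inner (V f) y + inner (D u) y"
    by (simp add: power2_norm_eq_inner y_def inner_add)
  also have "\<dots> = inner f (Vs y) + inner u (D y)"
    using assms by (simp add: inner_eq_Re_cinner cinner_V cinner_D)
  also have "\<dots> \<le> ((norm f)\<^sup>2 + (norm (Vs y))\<^sup>2) / 2 + ((norm u)\<^sup>2 + (norm (D y))\<^sup>2) / 2"
  proof (intro add_mono)
    have "inner a b \<le> ((norm a)\<^sup>2 + (norm b)\<^sup>2) / 2" for a b :: 'a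
    proof -
      have "0 \<le> (norm (a - b))\<^sup>2" by simp
      then show ?thesis
        unfolding power2_norm_eq_inner by (simp add: inner_diff inner_commute)
    qed
    then show "inner f (Vs y) \<le> ((norm f)\<^sup>2 + (norm (Vs y))\<^sup>2) / 2"
      "inner u (D y) \<le> ((norm u)\<^sup>2 + (norm (D y))\<^sup>2) / 2" by auto
  qed
  finally show ?thesis
    using norm_D[of y] by (simp add: y_def field_simps)
qed

lemma CS: "csubspace (C ` S)"
  unfolding csubspace_def
proof (intro conjI ballI allI)
  show "0 \<in> C ` S"
    using csubspace_zero[OF sub] by (metis C_zero imageI)
  show "x + y \<in> C ` S" if "x \<in> C ` S" "y \<in> C ` S" for x y
    using that by clarify (metis C_add csubspace_add[OF sub] imageI)
  show "a *\<^sub>C x \<in> C ` S" if "x \<in> C ` S" for a x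
    using that by clarify (metis C_scaleC complex_cnj_cnj csubspace_scaleC[OF sub] imageI)
qed

lemma D_ops_CS: "D \<in> bounded_ops (C ` S) UNIV"
  by (rule bounded_opsI[where K = 1]) (auto simp: D_add D_scaleC norm_D_le)

lemma L: "closed_csubspace L"
  unfolding L0_def by (intro closed_csubspace_closure csubspace_image[OF D_ops_CS] CS)

lemma D_C_in_L: "h \<in> S \<Longrightarrow> D (C h) \<in> L"
  unfolding L0_def using closure_subset by fast

text \<open>By \<open>C\<close>-symmetry \<open>V\<^sup>*Ch = P CVh\<close>, so both sides are complements of the same term:
  \<open>\<parallel>DCh\<parallel>\<^sup>2 = \<parallel>h\<parallel>\<^sup>2 - \<parallel>P CVh\<parallel>\<^sup>2\<close> and \<open>\<parallel>Q CVh\<parallel>\<^sup>2 = \<parallel>Vh\<parallel>\<^sup>2 - \<parallel>P CVh\<parallel>\<^sup>2\<close>.\<close>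

lemma norm_Q_C_V_le: assumes "h \<in> S" shows "norm (Q (C (V h))) \<le> norm (D (C h))"
proof (rule power2_le_imp_le)
  have "(norm (V h))\<^sup>2 \<le> (norm h)\<^sup>2"
    using V_norm[OF assms] by (simp add: power_mono)
  then show "(norm (Q (C (V h))))\<^sup>2 \<le> (norm (D (C h)))\<^sup>2"
    using norm_D[of "C h"] norm_proj_decomp[OF S, of "C (V h)"]
    unfolding Vs_C[OF assms] norm_C by linarith
qed simp

text \<open>Existence is the factorisation of \<open>Ch \<mapsto> Q CVh\<close> through \<open>D\<close>.  Uniqueness is continuity: the values on
  the dense subspace \<open>DCS\<close> of \<open>L0 C S V\<close> are prescribed.\<close>

lemma X_spec: "contraction L (ocompl S) X" "\<And>h. h \<in> S \<Longrightarrow> X (D (C h)) = Q (C (V h))"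
proof -
  define char where "char Y \<longleftrightarrow> Y \<in> extensional L \<and> contraction L (ocompl S) Y \<and>
    (\<forall>h\<in>S. Y (D (C h)) = Q (C (V h)))" for Y
  have "(\<lambda>k. Q (C (V (C k)))) \<in> bounded_ops (C ` S) (ocompl S)"
  proof (rule bounded_opsI[where K = 1])
    show "norm (Q (C (V (C x)))) \<le> 1 * norm x" if "x \<in> C ` S" for x
      using that norm_Q_C_V_le norm_D_le by (fastforce intro: order_trans)
  qed (auto simp: Q_into C_add C_scaleC V_add V_scaleC proj_add[OF closed_csubspace_ocompl] proj_scaleC[OF closed_csubspace_ocompl])
  then obtain Y where Y: "Y \<in> bounded_ops L (ocompl S)"
    "\<And>x. x \<in> C ` S \<Longrightarrow> Y (D x) = Q (C (V (C x)))" "\<And>z. z \<in> L \<Longrightarrow> norm (Y z) \<le> 1 * norm z"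
    unfolding L0_def
  proof (rule factor_through[OF CS D_ops_CS])
    show "norm (Q (C (V (C x)))) \<le> 1 * norm (D x)" if "x \<in> C ` S" for x
      using that norm_Q_C_V_le by auto
  qed (auto intro: closed_csubspaceD closed_csubspace_ocompl)
  have ex: "char (restrict Y L)"
    unfolding char_def contraction_def
  proof (intro conjI ballI)
    show "restrict Y L \<in> bounded_ops L (ocompl S)"
      using Y L by (intro bounded_opsI[where K = 1])
        (auto simp: bounded_ops_into bounded_ops_add bounded_ops_scaleC closed_csubspaceD
          csubspace_add csubspace_scaleC)
  qed (use Y in \<open>auto simp: D_C_in_L\<close>)
  have unique: "Z = Z'" if "char Z" "char Z'" for Z Z'
  proof (rule extensionalityI)
    show "Z \<in> extensional L" "Z' \<in> extensional L"
      using that by (auto simp: char_def)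
    have ops: "Z \<in> bounded_ops L (ocompl S)" "Z' \<in> bounded_ops L (ocompl S)"
      using that by (auto simp: char_def contraction_def)
    have "Z x - Z' x = 0" if "x \<in> L" for x
    proof (rule continuous_constant_on_closure[where f = "\<lambda>x. Z x - Z' x" and S = "D ` C ` S"])
      show "x \<in> closure (D ` C ` S)" using that by (simp add: L0_def)
      show "continuous_on (closure (D ` C ` S)) (\<lambda>x. Z x - Z' x)"
        unfolding L0_def[symmetric]
        by (intro continuous_on_diff bounded_ops_continuous_on[OF ops(1)]
            bounded_ops_continuous_on[OF ops(2)] closed_csubspaceD L)
    qed (use \<open>char Z\<close> \<open>char Z'\<close> in \<open>auto simp: char_def\<close>)
    then show "Z x = Z' x" if "x \<in> L" for x
      using that by simp
  qed
  have "X = (THE Y. char Y)"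
    unfolding X0_def char_def ..
  moreover have "char (THE Y. char Y)"
    using ex unique[OF _ ex] by (rule theI)
  ultimately have "char X" by simp
  then show "contraction L (ocompl S) X" "\<And>h. h \<in> S \<Longrightarrow> X (D (C h)) = Q (C (V h))"
    by (auto simp: char_def)
qed

lemma X_ops: "X \<in> bounded_ops L (ocompl S)" and X_norm: "z \<in> L \<Longrightarrow> norm (X z) \<le> norm z"
  using X_spec(1) by (auto simp: contraction_def)

lemma Xs_into: "Xs g \<in> L"
  unfolding X0_star_def by (rule adj_into[OF L X_ops])

lemma cinner_X: "z \<in> L \<Longrightarrow> cinner (X z) g = cinner z (Xs g)"
  unfolding X0_star_def by (rule cinner_adj[OF L X_ops])

lemma Xs_ops: "Xs \<in> bounded_ops (ocompl S) L"
  unfolding X0_star_def by (rule adj_bounded_ops[OF L X_ops])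

lemma Xs_norm: "norm (Xs g) \<le> norm g"
  unfolding X0_star_def using norm_adj_le[OF L X_ops, of 1] X_norm by simp

lemma Xs_add: "Xs (g + g') = Xs g + Xs g'"
  unfolding X0_star_def by (rule adj_add[OF L X_ops])

lemma Xt_into: "Xt x \<in> ocompl S"
  unfolding X0_tilde_def by (rule bounded_ops_into[OF X_ops proj_into[OF L]])

lemma Xt_norm: "norm (Xt x) \<le> norm x"
  unfolding X0_tilde_def using X_norm[OF proj_into[OF L]] norm_proj_le[OF L] by (rule order_trans)

lemma Xt_C: "h \<in> S \<Longrightarrow> Xt (D (C h)) = Q (C (V h))"
  by (simp add: X0_tilde_def proj_ident[OF L] D_C_in_L X_spec)

lemma cinner_Xt: "cinner (Xt x) g = cinner x (Xs g)"
  by (simp add: X0_tilde_def cinner_X proj_into[OF L] cinner_proj_left[OF L] Xs_into)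

lemma Xt_add: "Xt (x + y) = Xt x + Xt y" and Xt_scaleC: "Xt (a *\<^sub>C x) = a *\<^sub>C Xt x"
  by (simp_all add: X0_tilde_def proj_add[OF L] proj_scaleC[OF L] proj_into[OF L]
      bounded_ops_add[OF X_ops] bounded_ops_scaleC[OF X_ops])

text \<open>This is the adjoint of \<open>V_tilde C S V\<close>.  Its two summands are orthogonal, which makes it easier to
  estimate than the extension itself.\<close>

definition T where "T x = Vs x + Xt (D x)"

lemma cinner_T: "cinner (T x) y = cinner x (Vt y)"
proof -
  have "cinner (Vs x) y = cinner (Vs x) (P y)"
    by (simp add: cinner_proj_right[OF S] Vs_into)
  moreover have "cinner (Xt (D x)) y = cinner (Xt (D x)) (Q y)"
    by (simp add: cinner_proj_right[OF closed_csubspace_ocompl] Xt_into)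
  ultimately show ?thesis
    by (simp add: T_def V_tilde_def cinner_add_left cinner_add_right cinner_Vs P_into cinner_Xt cinner_D)
qed

lemma cinner_Vt: "cinner (Vt x) y = cinner x (T y)"
  using cinner_T[of y x] cinner_commute by metis

lemma T_ops: "T \<in> bounded_ops UNIV UNIV"
  and norm_T_le: "norm (T x) \<le> norm x"
proof -
  show norm: "norm (T x) \<le> norm x" for x
  proof (rule power2_le_imp_le)
    have "(norm (T x))\<^sup>2 = (norm (Vs x))\<^sup>2 + (norm (Xt (D x)))\<^sup>2"
      unfolding T_def by (intro norm_add_orthogonal ocomplD'[OF Xt_into Vs_into])
    also have "\<dots> \<le> (norm (Vs x))\<^sup>2 + (norm (D x))\<^sup>2"
      by (simp add: Xt_norm power_mono)
    finally show "(norm (T x))\<^sup>2 \<le> (norm x)\<^sup>2"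
      using norm_D[of x] by linarith
  qed simp
  show "T \<in> bounded_ops UNIV UNIV"
    by (rule bounded_opsI[where K = 1])
      (simp_all add: norm, simp_all add: T_def Vs_add Vs_scaleC D_add D_scaleC Xt_add Xt_scaleC
        scaleC_add_right)
qed

lemma Vt_eq_adj: "Vt = adj UNIV UNIV T"
  by (rule ext, rule sym, rule adj_eqI) (simp_all add: closed_csubspaceD cinner_T)

lemma adj_Vt: "adj UNIV UNIV Vt = T"
  by (rule ext, rule adj_eqI) (simp_all add: closed_csubspaceD cinner_Vt)

lemma Vt_contraction: "contraction UNIV UNIV Vt"
  unfolding contraction_def Vt_eq_adj
  using norm_adj_le[OF closed_csubspace_UNIV T_ops, of 1] norm_T_le
  by (simp add: adj_bounded_ops[OF closed_csubspace_UNIV T_ops])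

lemma T_C: "h \<in> S \<Longrightarrow> T (C h) = C (V h)"
  using proj_decomp[OF S, of "C (V h)"] by (simp add: T_def Vs_C Xt_C)

lemma Vt_S: assumes "f \<in> S" shows "Vt f = V f"
proof -
  have "proj (ocompl S) f = 0"
    using assms by (simp add: proj_ocompl[OF S] proj_ident[OF S])
  moreover have "Xs 0 = 0"
    using Xs_add[of 0 0] by simp
  ultimately show ?thesis
    using assms by (simp add: V_tilde_def proj_ident[OF S] D_zero)
qed

lemma Vt_ocompl: assumes "g \<in> ocompl S" shows "Vt g = D (Xs g)"
proof -
  have "P g = 0"
    using proj_ident[OF closed_csubspace_ocompl assms] by (simp add: proj_ocompl[OF S])
  moreover have "V 0 = 0" using bounded_ops_zero[OF V_ops sub] .
  ultimately show ?thesis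
    using assms by (simp add: V_tilde_def proj_ident[OF closed_csubspace_ocompl])
qed

abbreviation pair_extension where
  "pair_extension W \<equiv> contractive_pair_extension S V (C ` S) (\<lambda>h. C (V (C h))) W"

lemma Vt_pair: "pair_extension Vt"
  unfolding contractive_pair_extension_def extends_def
  by (auto simp: Vt_contraction Vt_S adj_Vt T_C)

lemma in_C_ocomplI: "w \<in> C ` ocompl S" if "\<And>h. h \<in> S \<Longrightarrow> cinner (C h) w = 0"
proof -
  have "C w \<in> ocompl S"
    using that by (auto simp: ocompl_def cinner_C_left)
  then show ?thesis by (metis C_C imageI)
qed

text \<open>Any contractive extension \<open>W\<close> of \<open>V\<close> has \<open>P W\<^sup>* = V\<^sup>*\<close>, which leaves only
  \<open>\<parallel>x\<parallel>\<^sup>2 - \<parallel>V\<^sup>*x\<parallel>\<^sup>2 = \<parallel>Dx\<parallel>\<^sup>2\<close> for the component of \<open>W\<^sup>*x\<close> orthogonal to \<open>S\<close>.\<close>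

lemma
  assumes "contraction UNIV UNIV W" "extends W S V"
  shows P_adj_extension: "P (adj UNIV UNIV W x) = Vs x"
    and norm_Q_adj_extension_le: "norm (Q (adj UNIV UNIV W x)) \<le> norm (D x)"
proof -
  have W: "W \<in> bounded_ops UNIV UNIV" "\<And>x. norm (W x) \<le> norm x"
    using assms by (auto simp: contraction_def)
  note [simp] = cinner_adj[OF closed_csubspace_UNIV W(1), of _ _ UNIV, symmetric]
  show eq: "P (adj UNIV UNIV W x) = Vs x"
    using assms by (intro sym[OF adj_eqI[OF sub P_into]])
      (simp add: extends_def cinner_proj_right[OF S])
  have "norm (adj UNIV UNIV W x) \<le> norm x"
    using norm_adj_le[OF closed_csubspace_UNIV W(1), of 1] W(2) by simp
  then have "(norm (adj UNIV UNIV W x))\<^sup>2 \<le> (norm x)\<^sup>2"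
    by (simp add: power_mono)
  then have "(norm (Q (adj UNIV UNIV W x)))\<^sup>2 \<le> (norm (D x))\<^sup>2"
    using norm_D[of x] norm_proj_decomp[OF S, of "adj UNIV UNIV W x"] unfolding eq by linarith
  then show "norm (Q (adj UNIV UNIV W x)) \<le> norm (D x)"
    by (rule power2_le_imp_le) simp
qed

text \<open>Passing from \<open>W\<close> to \<open>CW\<^sup>*C\<close> exchanges the conditions \<open>W \<supset> V\<close> and \<open>W\<^sup>* \<supset> CVC\<close>.  Uniqueness of the pair
  extension therefore forces \<open>C\<close>-self-adjointness.\<close>

lemma conjugated_adjoint_pair:
  "pair_extension (\<lambda>x. C (T (C x)))"
proof -
  have "contraction UNIV UNIV (\<lambda>x. C (T (C x)))"
    unfolding contraction_def using T_ops norm_T_le[of "C _"]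
    by (intro conjI bounded_opsI[where K = 1])
      (simp_all add: C_add C_scaleC bounded_ops_add bounded_ops_scaleC)
  moreover have "adj UNIV UNIV (\<lambda>x. C (T (C x))) = (\<lambda>x. C (Vt (C x)))"
  proof (rule ext, rule adj_eqI)
    fix x z
    have "cinner (C (T (C z))) x = cinner (C x) (T (C z))"
      using cinner_C[of "T (C z)" "C x"] by simp
    also have "\<dots> = cinner (Vt (C x)) (C z)"
      by (simp add: cinner_Vt)
    also have "\<dots> = cinner z (C (Vt (C x)))"
      by (rule cinner_C_right)
    finally show "cinner (C (T (C z))) x = cinner z (C (Vt (C x)))" .
  qed (simp_all add: closed_csubspaceD)
  ultimately show ?thesis
    unfolding contractive_pair_extension_def extends_def
    by (auto simp: T_C Vt_S)
qed

lemma C_selfadjoint_imp_pair: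
  assumes "C_selfadjoint_contractive_extension C S V W"
  shows "pair_extension W"
proof -
  have "adj UNIV UNIV W (C x) = C (W x)" for x
    using assms unfolding C_selfadjoint_contractive_extension_def C_selfadjoint_def by (metis C_C)
  then show ?thesis
    using assms unfolding C_selfadjoint_contractive_extension_def contractive_pair_extension_def extends_def
    by auto
qed

end

section \<open>Consequences of the trivial intersection\<close>

locale determined_symmetric_contraction = symmetric_contraction +
  assumes trivial: "range (D_Vstar S V) \<inter> C ` ocompl S = {0}"
begin

text \<open>Majorisation by \<open>D\<close> puts \<open>w\<close> into the range of \<open>D\<close>, hence into the trivial intersection.  Uniqueness of
  the extension and isometry of \<open>X\<^sub>0\<^sup>*\<close> both come from this.\<close>

lemma vanishes_if_majorised:
  assumes "w \<in> C ` ocompl S" "\<And>x. cmod (cinner x w) \<le> K * norm (D x)" "0 \<le> K"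
  shows "w = 0"
  using trivial assms in_range_if_majorised[OF D_ops cinner_D assms(2,3)] by blast

text \<open>For \<open>g\<close> orthogonal to \<open>S\<close>, the vector \<open>w = W\<^sub>1g - W\<^sub>2g\<close> is orthogonal to \<open>CS\<close>, since \<open>W\<^sub>1\<^sup>*\<close> and \<open>W\<^sub>2\<^sup>*\<close> agree
  there, and it is majorised by \<open>D\<close>, since \<open>W\<^sub>1\<^sup>*y - W\<^sub>2\<^sup>*y\<close> is a difference of two vectors of norm at most \<open>\<parallel>Dy\<parallel>\<close>.\<close>

lemma pair_extension_unique:
  assumes W1: "pair_extension W1" and W2: "pair_extension W2"
  shows "W1 = W2"
proof
  fix x
  have con: "contraction UNIV UNIV W1" "contraction UNIV UNIV W2"
    and ext: "extends W1 S V" "extends W2 S V"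
    and adj_C: "\<And>h. h \<in> S \<Longrightarrow> adj UNIV UNIV W1 (C h) = adj UNIV UNIV W2 (C h)"
    using W1 W2 by (auto simp: contractive_pair_extension_def extends_def)
  have ops: "W1 \<in> bounded_ops UNIV UNIV" "W2 \<in> bounded_ops UNIV UNIV"
    using con by (auto simp: contraction_def)
  let ?A1 = "adj UNIV UNIV W1" and ?A2 = "adj UNIV UNIV W2"
  have cin: "cinner y (W1 z) = cinner (?A1 y) z" "cinner y (W2 z) = cinner (?A2 y) z" for y z
    using cinner_adj[OF closed_csubspace_UNIV ops(1), of z y UNIV]
      cinner_adj[OF closed_csubspace_UNIV ops(2), of z y UNIV] cinner_commute by (metis UNIV_I)+
  have Q_eq: "W1 g - W2 g = 0" if g: "g \<in> ocompl S" for g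
  proof (rule vanishes_if_majorised)
    have eq: "cinner y (W1 g - W2 g) = cinner (?A1 y - ?A2 y) g" for y
      by (simp add: cinner_diff_left cinner_diff_right cin)
    show "W1 g - W2 g \<in> C ` ocompl S"
      by (rule in_C_ocomplI) (simp add: eq adj_C)
    fix y
    have Qs: "?A1 y - ?A2 y = Q (?A1 y) - Q (?A2 y)"
      by (simp add: proj_ocompl[OF S] P_adj_extension con ext)
    have le: "norm (?A1 y - ?A2 y) \<le> 2 * norm (D y)"
      unfolding Qs using norm_Q_adj_extension_le[OF con(1) ext(1), of y] norm_Q_adj_extension_le[OF con(2) ext(2), of y]
        norm_triangle_ineq4[of "Q (?A1 y)" "Q (?A2 y)"] by linarith
    show "cmod (cinner y (W1 g - W2 g)) \<le> (2 * norm g) * norm (D y)"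
      unfolding eq using cmod_cinner_le[of "?A1 y - ?A2 y" g] mult_right_mono[OF le, of "norm g"]
      by (simp add: algebra_simps)
  qed simp
  have "W1 x = W1 (P x) + W1 (Q x)" "W2 x = W2 (P x) + W2 (Q x)"
    using proj_decomp[OF S, of x] ops by (metis UNIV_I bounded_ops_add)+
  then show "W1 x = W2 x"
    using Q_eq[OF Q_into, of x] ext P_into[of x] by (simp add: extends_def)
qed

lemma C_T_C: "C (T (C x)) = Vt x"
  using pair_extension_unique[OF conjugated_adjoint_pair Vt_pair] by (rule fun_cong)

lemma W0_eq: "W0_tilde C S V = Vt"
proof
  fix x
  have "(1/2) *\<^sub>C (Vt x + Vt x) = ((1/2 + 1/2) :: complex) *\<^sub>C Vt x"
    by (simp only: scaleC_add_left scaleC_add_right)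
  then show "W0_tilde C S V x = Vt x"
    by (simp add: W0_tilde_def adj_Vt C_T_C)
qed

lemma Vt_C_selfadjoint: "C_selfadjoint_contractive_extension C S V Vt"
  unfolding C_selfadjoint_contractive_extension_def C_selfadjoint_def extends_def
  using Vt_contraction by (auto simp: Vt_S adj_Vt C_T_C contraction_def)

text \<open>This is the component orthogonal to \<open>S\<close> of the identity \<open>C W f = W\<^sup>* C f\<close>, where \<open>W\<close> is the extension
  and \<open>W f = D X\<^sub>0\<^sup>* f\<close>.\<close>

lemma projected_symmetry:
  assumes "f \<in> ocompl S"
  shows "Q (C (D (Xs f))) = Xt (D (C f))"
proof -
  have "C (D (Xs f)) = T (C f)"
    using C_T_C[of f] Vt_ocompl[OF assms] by (metis C_C)
  then show ?thesis
    using proj_ident[OF closed_csubspace_ocompl Xt_into]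
    by (simp add: T_def proj_add[OF closed_csubspace_ocompl] proj_ocompl[OF S] proj_ident[OF S] Vs_into)
qed

lemma DD_eq: "DD_Vstar S V = closure (range D)"
  by (simp add: DD_Vstar_def defect_space_def D_Vstar_def)

text \<open>The part \<open>y\<close> of \<open>Dx\<close> orthogonal to \<open>DCS\<close> satisfies \<open>Dy \<bottom> CS\<close>, so \<open>Dy\<close> lies in the trivial intersection;
  hence \<open>(y, Dx) = 0\<close> and \<open>y = 0\<close>.\<close>

lemma L_eq: "L = DD_Vstar S V"
proof
  show "L \<subseteq> DD_Vstar S V"
    unfolding DD_eq L0_def by (intro closure_mono) auto
  have "range D \<subseteq> L"
  proof clarify
    fix x
    define y where "y = D x - proj L (D x)"
    have y: "y \<in> ocompl L"
      unfolding y_def by (rule diff_proj_in_ocompl[OF L])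
    have "cinner (C h) (D y) = 0" if "h \<in> S" for h
      using ocomplD'[OF y D_C_in_L[OF that]] by (simp add: cinner_D)
    then have "D y \<in> C ` ocompl S" by (rule in_C_ocomplI)
    then have "D y = 0" using trivial by blast
    then have "cinner y (D x) = 0"
      by (simp flip: cinner_D)
    moreover have "cinner y (proj L (D x)) = 0"
      using y proj_into[OF L] by (rule ocomplD)
    ultimately have "cinner y y = 0"
      by (subst (2) y_def) (simp add: cinner_diff_right)
    then have "D x = proj L (D x)"
      by (simp add: cinner_self y_def)
    then show "D x \<in> L" using proj_into[OF L] by metis
  qed
  then show "DD_Vstar S V \<subseteq> L"
    unfolding DD_eq by (rule closure_minimal) (rule closed_csubspaceD[OF L])
qed

text \<open>The defect \<open>I - X\<^sub>0X\<^sub>0\<^sup>*\<close> of \<open>X\<^sub>0\<^sup>*\<close> at \<open>g\<close> is bounded by the defect of the extension \<open>W\<close> at any \<open>x\<close> with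
  \<open>Qx = g\<close>.  Since \<open>W = CW\<^sup>*C\<close>, that defect equals the one of \<open>W\<^sup>*\<close> at \<open>Cx\<close>, which the defect of
  \<open>V\<^sup>*\<close> dominates.  For the first bound, \<open>\<parallel>Gg\<parallel>\<^sup>2 \<le> (Gg, g)\<close> because \<open>G = I - X\<^sub>0X\<^sub>0\<^sup>*\<close> lies between \<open>0\<close> and \<open>I\<close>,
  and the contractive row \<open>(V, D)\<close> gives \<open>\<parallel>Wx\<parallel>\<^sup>2 \<le> \<parallel>Px\<parallel>\<^sup>2 + \<parallel>X\<^sub>0\<^sup>*g\<parallel>\<^sup>2\<close>.\<close>

lemma norm_X_Xs_defect_le:
  assumes "g = Q x"
  shows "(norm (g - X (Xs g)))\<^sup>2 \<le> (norm (D (C x)))\<^sup>2"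
proof -
  define u where "u = Xs g"
  have g: "g \<in> ocompl S" by (simp add: assms Q_into)
  have u: "u \<in> L" by (simp add: u_def Xs_into)
  have "inner (X u) g = inner u u"
    using cinner_X[OF u, of g] by (simp add: inner_eq_Re_cinner u_def)
  then have "inner g (X u) = inner u u"
    by (subst inner_commute)
  then have "(norm (g - X u))\<^sup>2 = (norm g)\<^sup>2 - 2 * (norm u)\<^sup>2 + (norm (X u))\<^sup>2"
    unfolding power2_norm_eq_inner by (simp add: inner_diff inner_commute)
  also have "\<dots> \<le> (norm g)\<^sup>2 - (norm u)\<^sup>2"
    using power_mono[OF X_norm[OF u], of 2] by simp
  also have "\<dots> \<le> (norm x)\<^sup>2 - (norm (Vt x))\<^sup>2"
  proof -
    have "Vt x = V (P x) + D u"
      by (simp add: V_tilde_def u_def assms)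
    then have "(norm (Vt x))\<^sup>2 \<le> (norm (P x))\<^sup>2 + (norm u)\<^sup>2"
      by (simp add: norm_row_le P_into)
    then show ?thesis
      using norm_proj_decomp[OF S, of x] by (simp add: assms)
  qed
  also have "\<dots> = (norm (C x))\<^sup>2 - (norm (T (C x)))\<^sup>2"
    by (simp flip: C_T_C)
  also have "\<dots> \<le> (norm (C x))\<^sup>2 - (norm (Vs (C x)))\<^sup>2"
    unfolding T_def
    using norm_add_orthogonal[OF ocomplD'[OF Xt_into Vs_into], of "C x" "D (C x)"] by simp
  also have "\<dots> = (norm (D (C x)))\<^sup>2"
    using norm_D[of "C x"] by simp
  finally show ?thesis by (simp add: u_def)
qed

text \<open>With \<open>G = I - X\<^sub>0X\<^sub>0\<^sup>*\<close>, the functional \<open>y \<mapsto> (y, CGk)\<close> equals \<open>(k, GQCy)\<close>, which is majorised by \<open>D\<close>.\<close>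

lemma X_Xs: assumes k: "k \<in> ocompl S" shows "X (Xs k) = k"
proof -
  define G where "G g = g - X (Xs g)" for g
  have G_into: "G g \<in> ocompl S" if "g \<in> ocompl S" for g
    unfolding G_def using that
    by (intro csubspace_diff closed_csubspaceD closed_csubspace_ocompl bounded_ops_into[OF X_ops] Xs_into)
  have G_sym: "cinner (G g) h = cinner g (G h)" for g h
  proof -
    have "cinner g (X (Xs h)) = cnj (cinner (X (Xs h)) g)"
      by (rule cinner_commute)
    also have "\<dots> = cnj (cinner (Xs h) (Xs g))"
      by (simp add: cinner_X Xs_into)
    also have "\<dots> = cinner (X (Xs g)) h"
      using cinner_commute[of "Xs g" "Xs h"] by (simp add: cinner_X Xs_into)
    finally show ?thesis
      by (simp add: G_def cinner_diff_left cinner_diff_right)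
  qed
  have "C (G k) = 0"
  proof (rule vanishes_if_majorised)
    show "C (G k) \<in> C ` ocompl S" using G_into[OF k] by simp
    fix y
    have "cinner y (C (G k)) = cinner (G k) (C y)"
      by (rule cinner_C_right)
    also have "\<dots> = cinner (G k) (Q (C y))"
      using G_into[OF k] by (simp add: cinner_proj_right[OF closed_csubspace_ocompl])
    also have "\<dots> = cinner k (G (Q (C y)))"
      by (rule G_sym)
    finally have "cmod (cinner y (C (G k))) \<le> norm k * norm (G (Q (C y)))"
      by (simp add: cmod_cinner_le)
    moreover have "norm (G (Q (C y))) \<le> norm (D y)"
      using norm_X_Xs_defect_le[OF refl, of "C y"] unfolding C_C G_def
      by (rule power2_le_imp_le) (rule norm_ge_zero)
    ultimately show "cmod (cinner y (C (G k))) \<le> norm k * norm (D y)"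
      by (meson mult_left_mono norm_ge_zero order_trans)
  qed simp
  then have "G k = 0" by (metis C_C C_zero)
  then show ?thesis by (simp add: G_def)
qed

lemma X_coisometry: "coisometry L (ocompl S) X"
  unfolding coisometry_def isometry_def X0_star_def[symmetric]
proof (intro conjI ballI X_ops Xs_ops)
  fix k assume k: "k \<in> ocompl S"
  then have "norm k \<le> norm (Xs k)"
    using X_norm[OF Xs_into, of k] by (simp add: X_Xs)
  then show "norm (Xs k) = norm k"
    using Xs_norm[of k] by simp
qed

end

theorem theorem3p8:
  fixes C V :: "'a::complex_hilbert \<Rightarrow> 'a" and S :: "'a set"
  assumes "conjugation C"
    and "closed_csubspace S"
    and "contraction S UNIV V"
    and "C_symmetric C S V"
    and "range (D_Vstar S V) \<inter> C ` ocompl S = {0}"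
  shows "W0_tilde C S V = V_tilde C S V \<and>
    (L0 C S V = DD_Vstar S V \<and> coisometry (L0 C S V) (ocompl S) (X0 C S V)) \<and>
    (\<forall>f\<in>ocompl S.
      proj (ocompl S) (C (D_Vstar S V (X0_star C S V f))) = X0_tilde C S V (D_Vstar S V (C f))) \<and>
    (C_selfadjoint_contractive_extension C S V (W0_tilde C S V) \<and>
      (\<forall>W. C_selfadjoint_contractive_extension C S V W \<longrightarrow> W = W0_tilde C S V)) \<and>
    (contractive_pair_extension S V (C ` S) (\<lambda>h. C (V (C h))) (W0_tilde C S V) \<and>
      (\<forall>W. contractive_pair_extension S V (C ` S) (\<lambda>h. C (V (C h))) W \<longrightarrow> W = W0_tilde C S V))"
proof -
  interpret determined_symmetric_contraction C V S
    by unfold_locales (rule assms)+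
  have pair_unique: "W = Vt" if "pair_extension W" for W
    using that Vt_pair by (rule pair_extension_unique)
  have C_unique: "W = Vt" if "C_selfadjoint_contractive_extension C S V W" for W
    using that by (intro pair_unique C_selfadjoint_imp_pair)
  show ?thesis
    unfolding W0_eq
    by (intro conjI allI impI ballI refl L_eq X_coisometry projected_symmetry Vt_C_selfadjoint
        Vt_pair) (simp_all add: C_unique pair_unique)
qed

end
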